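(* Let $p$ be a sufficiently large prime and let $F(X)\in\mathbb{F}_p[X]$ be a square-free polynomial of degree $d_F\geq 1$. Then for every integer $m$ with $2\leq m\ll(\log p)^{1/4}$, $$\sum_{a=0}^{m-1}\left(\widetilde{\Phi}_p(F;m,a)-\frac{1}{m}\right)^2\ll_{d_F}\frac{m^2}{\log p}.$$ The same bound holds when $R_p(F,k)$ is replaced by $N_p(F,k)$ in the definition of $\widetilde{\Phi}_p$.
   Context: $\chi_p$ denotes the Legendre symbol modulo $p$. For $1\le k\le p$, $R_p(F,k)$ is the number of positive integers $n\leq k$ such that $F(n)$ is a quadratic residue modulo $p$ (i.e. $\chi_p(F(n))=1$), and $N_p(F,k)$ is the number of positive integers $n\leq k$ such that $F(n)$ is a quadratic non-residue modulo $p$. For an integer $m\ge2$ and residue $a$, $\widetilde{\Phi}_p(F;m,a)=\frac{1}{p}\left|\{1\leq k\leq p: R_p(F,k)\equiv a\bmod m\}\right|$. *)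

theory Defs
  imports
    Complex_Main
    "HOL-Number_Theory.Number_Theory"
    "Berlekamp_Zassenhaus.Poly_Mod"
begin

text \<open>
  An element of \<open>GF(p)[X]\<close> is represented by any integer polynomial \<open>F\<close> that reduces to it modulo
  \<open>p\<close>: the notions \<open>degree_m\<close> and \<open>square_free_m\<close> at modulus \<open>p\<close> are
  the degree and the square-freeness of the reduction. The counts below depend on \<open>F\<close> only modulo
  \<open>p\<close>, because the Legendre symbol does.
\<close>

definition R_count :: "nat \<Rightarrow> int poly \<Rightarrow> nat \<Rightarrow> nat" where
  "R_count p F k = card {n \<in> {1..k}. Legendre (poly F (int n)) (int p) = 1}"

definition N_count :: "nat \<Rightarrow> int poly \<Rightarrow> nat \<Rightarrow> nat" where
  "N_count p F k = card {n \<in> {1..k}. Legendre (poly F (int n)) (int p) = -1}"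

text \<open>
  The density of \<open>k \<in> {1..p}\<close> with \<open>c k \<equiv> a\<close> modulo \<open>m\<close>, for \<open>c\<close> one of the two counting
  functions above.
\<close>

definition Phi :: "nat \<Rightarrow> (nat \<Rightarrow> nat) \<Rightarrow> nat \<Rightarrow> nat \<Rightarrow> real" where
  "Phi p c m a = real (card {k \<in> {1..p}. [c k = a] (mod m)}) / real p"

end

theory Submission
  imports Defs "Berlekamp_Zassenhaus.Poly_Mod_Finite_Field"
begin

text \<open>
  Let \<open>s n\<close> be the Legendre symbol of \<open>F n\<close> and \<open>c k\<close> the number of \<open>n \<le> k\<close> with \<open>s n = e\<close>. Up to
  boundary terms the indicator of \<open>c k \<equiv> a\<close> may be averaged over a window \<open>k = n + i\<close>, \<open>i < h\<close>.
  By Cauchy-Schwarz the sum over \<open>a\<close> of the squared discrepancies is then controlled by the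
  number of \<open>n\<close> with \<open>c (n + i) \<equiv> c (n + j)\<close> modulo \<open>m\<close>, for \<open>i, j < h\<close>. This is a condition on
  the pattern of signs \<open>s (n + i + 1), \<dots>, s (n + j)\<close>. By Weil's bound for the character sums with
  argument \<open>\<Prod>i\<in>S. F (n + i)\<close> all patterns of length at most \<open>h\<close>, about \<open>log 2 p / 8\<close>, are
  nearly equally frequent, so these counts are at most about \<open>p\<close> times the proportion of subsets
  of an \<open>l\<close>-element set whose cardinality is divisible by \<open>m\<close>, \<open>l = \<bar>i - j\<bar>\<close>. The excess of that
  proportion over \<open>1/m\<close>, summed over \<open>l\<close>, is at most 2, which leaves a discrepancy of order \<open>1/h\<close>.

  Weil's bound is obtained by Stepanov's method: with \<open>p = 2 q + 1\<close>, a nonzero polynomial of low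
  degree that vanishes to high order at every \<open>x\<close> with \<open>f x ^ q = e\<close> bounds the number of such \<open>x\<close>.
\<close>

subsection \<open>Stepanov's method\<close>

text \<open>Pigeonhole in place of a rank argument: there are more functions on \<open>I\<close>
  than tuples of values on \<open>E\<close>, so two of them agree under every \<open>L e\<close>,
  and their difference is the required vector.\<close>

lemma exists_nonzero_kernel_vector:
  fixes L :: "'e \<Rightarrow> ('i \<Rightarrow> 'a::{finite,comm_ring_1}) \<Rightarrow> 'a"
  assumes "finite E" "finite I" "card E < card I"
    and diff: "\<And>e v w. L e (\<lambda>i. v i - w i) = L e v - L e w"
  obtains v where "\<exists>i\<in>I. v i \<noteq> 0" "\<And>e. e \<in> E \<Longrightarrow> L e v = 0"
proof -
  let ?V = "PiE I (\<lambda>_. UNIV :: 'a set)" and ?W = "PiE E (\<lambda>_. UNIV :: 'a set)"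
  let ?g = "\<lambda>v. restrict (\<lambda>e. L e v) E"
  have "card {0, 1 :: 'a} \<le> CARD('a)" by (intro card_mono) auto
  hence "CARD('a) > 1" by simp
  hence "card ?W < card ?V"
    using assms by (simp add: card_PiE)
  moreover have "?g ` ?V \<subseteq> ?W" by auto
  moreover have "finite ?W" using assms by (simp add: finite_PiE)
  ultimately have "card (?g ` ?V) < card ?V"
    by (meson card_mono le_less_trans)
  hence "\<not> inj_on ?g ?V" by (rule pigeonhole)
  then obtain v w where vw: "v \<in> ?V" "w \<in> ?V" "v \<noteq> w" "?g v = ?g w"
    by (auto simp: inj_on_def)
  show thesis
  proof
    show "\<exists>i\<in>I. v i - w i \<noteq> 0"
      using vw by (metis PiE_ext eq_iff_diff_eq_0)
    show "L e (\<lambda>i. v i - w i) = 0" if "e \<in> E" for e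
      using that fun_cong[OF vw(4), of e] by (simp add: diff)
  qed
qed

text \<open>Let \<open>P = (X - x)^M Q\<close> in the step from \<open>M\<close> to
  \<open>Suc M\<close>. The induction hypothesis for \<open>pderiv P\<close> shows that
  \<open>(X - x)^M\<close> also divides \<open>M (X - x)^(M - 1) Q\<close>, so \<open>X - x\<close>
  divides \<open>Q\<close> because \<open>M\<close> is invertible. The condition on
  \<open>of_nat k\<close> keeps \<open>M\<close> from exceeding a positive characteristic.\<close>

lemma power_dvd_if_pderivs_vanish:
  fixes P :: "'a::field poly"
  assumes "\<And>k. k < M \<Longrightarrow> poly ((pderiv ^^ k) P) x = 0"
    and "\<And>k. 0 < k \<Longrightarrow> k < M \<Longrightarrow> (of_nat k :: 'a) \<noteq> 0"
  shows "[:-x, 1:] ^ M dvd P"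
  using assms
proof (induction M arbitrary: P)
  case (Suc M)
  show ?case
  proof (cases "M = 0")
    case True
    then show ?thesis using Suc.prems(1)[of 0] by (simp add: poly_eq_0_iff_dvd)
  next
    case False
    have "[:-x, 1:] ^ M dvd P" using Suc.IH[of P] Suc.prems by simp
    then obtain Q where Q: "P = [:-x, 1:] ^ M * Q" by (elim dvdE)
    have "poly ((pderiv ^^ k) (pderiv P)) x = 0" if "k < M" for k
      using Suc.prems(1)[of "Suc k"] that by (simp add: funpow_Suc_right del: funpow.simps)
    hence "[:-x, 1:] ^ M dvd pderiv P" using Suc.IH[of "pderiv P"] Suc.prems(2) by simp
    also have "pderiv P = [:-x, 1:] ^ M * pderiv Q + smult (of_nat M) ([:-x,1:] ^ (M - 1) * Q)"
      unfolding Q pderiv_mult pderiv_power by (simp add: pderiv_pCons mult.commute)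
    finally have "[:-x, 1:] ^ M dvd smult (of_nat M) ([:-x,1:] ^ (M - 1) * Q)"
      by (metis dvd_add_right_iff dvd_triv_left)
    hence "[:-x, 1:] ^ Suc (M - 1) dvd [:-x,1:] ^ (M - 1) * Q"
      using Suc.prems(2)[of M] False by (auto dest: dvd_smult_cancel)
    hence "[:-x, 1:] dvd Q" unfolding power_Suc2 by (subst (asm) dvd_mult_cancel_left) auto
    thus ?thesis unfolding Q power_Suc2 by (rule mult_dvd_mono[OF dvd_refl])
  qed
qed simp

lemma card_mult_le_degree_if_power_dvd:
  fixes P :: "'a::idom poly"
  assumes "P \<noteq> 0" "finite S" "\<And>x. x \<in> S \<Longrightarrow> [:-x, 1:] ^ M dvd P"
  shows "card S * M \<le> degree P"
proof (cases "M = 0")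
  case False
  have fin: "finite {x. poly P x = 0}" using assms(1) by (rule poly_roots_finite)
  have "S \<subseteq> {x. poly P x = 0}"
  proof
    fix x assume "x \<in> S"
    from assms(3)[OF this] False have "[:-x, 1:] dvd P"
      by (metis dvd_power dvd_trans gr0I)
    thus "x \<in> {x. poly P x = 0}" by (simp add: poly_eq_0_iff_dvd)
  qed
  have "card S * M = (\<Sum>x\<in>S. M)" by simp
  also have "\<dots> \<le> (\<Sum>x\<in>S. order x P)"
    using assms by (intro sum_mono order_max) auto
  also have "\<dots> \<le> (\<Sum>x | poly P x = 0. order x P)"
    using fin \<open>S \<subseteq> _\<close> by (intro sum_mono2) auto
  also have "\<dots> \<le> degree P" using assms(1) by (rule order_sum_degree)
  finally show ?thesis .
qed simp

text \<open>
  The cofactor \<open>r\<^sub>k\<close> in the identity \<open>D\<^sup>k (f\<^sup>c r) = f\<^bsup>c - k\<^esup> r\<^sub>k\<close>; its degree grows by at most \<open>degree f\<close>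
  at each step, independently of \<open>c\<close>.
\<close>

primrec pderiv_cofactor :: "'a::idom poly \<Rightarrow> nat \<Rightarrow> nat \<Rightarrow> 'a poly \<Rightarrow> 'a poly" where
  "pderiv_cofactor f c 0 r = r"
| "pderiv_cofactor f c (Suc k) r =
     smult (of_nat (c - k)) (pderiv f * pderiv_cofactor f c k r) + f * pderiv (pderiv_cofactor f c k r)"

lemma pderiv_cofactor_diff:
  "pderiv_cofactor f c k (r - s) = pderiv_cofactor f c k r - pderiv_cofactor f c k s"
  by (induction k) (simp_all add: pderiv_diff right_diff_distrib smult_diff_right)

lemma degree_pderiv_cofactor:
  fixes f :: "'a::idom poly"
  shows "degree (pderiv_cofactor f c k r) \<le> degree r + k * degree f"
proof (induction k)
  case (Suc k)
  let ?t = "pderiv_cofactor f c k r"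
  have d: "degree (pderiv g) \<le> degree g" for g :: "'a poly"
  proof (rule degree_le, safe)
    fix i assume "degree g < i"
    hence "coeff g (Suc i) = 0" by (intro coeff_eq_0) auto
    thus "coeff (pderiv g) i = 0" by (simp add: coeff_pderiv)
  qed
  have "degree (pderiv f * ?t) \<le> degree f + degree ?t"
    using degree_mult_le[of "pderiv f" ?t] d[of f] by simp
  moreover have "degree (f * pderiv ?t) \<le> degree f + degree ?t"
    using degree_mult_le[of f "pderiv ?t"] d[of ?t] by simp
  ultimately have "degree (pderiv_cofactor f c (Suc k) r) \<le> degree f + degree ?t"
    by (auto intro!: degree_add_le order_trans[OF degree_smult_le])
  with Suc show ?case by simp
qed simp

text \<open>The factor \<open>h\<close> behaves like a constant; it will be a power of
  \<open>X ^ p\<close>. Each derivative costs one factor \<open>f\<close>, hence the condition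
  \<open>k \<le> c\<close>.\<close>

lemma funpow_pderiv_power_mult:
  fixes f :: "'a::idom poly"
  assumes "pderiv h = 0" "k \<le> c"
  shows "(pderiv ^^ k) (f ^ c * r * h) = f ^ (c - k) * pderiv_cofactor f c k r * h"
  using assms(2)
proof (induction k)
  case (Suc k)
  then obtain n where n: "c - k = Suc n" "c - Suc k = n"
    by (metis Suc_diff_Suc Suc_le_lessD)
  have "(pderiv ^^ Suc k) (f ^ c * r * h) = pderiv (f ^ Suc n * pderiv_cofactor f c k r * h)"
    using Suc n by simp
  also have "\<dots> = f ^ n * pderiv_cofactor f c (Suc k) r * h"
    unfolding pderiv_mult assms(1) pderiv_cofactor.simps n pderiv_power_Suc
    by (simp add: algebra_simps smult_add_left)
  finally show ?case using n by simp
qed simp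

text \<open>
  Over a field: \<open>f\<close> is nonzero and not a constant multiple of a square of a rational function.
\<close>

definition nonsquare_poly :: "'a::comm_ring_1 poly \<Rightarrow> bool" where
  "nonsquare_poly f \<longleftrightarrow> (\<forall>c r s. r\<^sup>2 * f = smult c (s\<^sup>2) \<longrightarrow> r = 0)"

section \<open>Derivatives and \<open>p\<close>-th powers in characteristic \<open>p\<close>\<close>

lemma coeff_eq_0_if_pderiv_eq_0:
  fixes g :: "'a::idom poly"
  assumes "pderiv g = 0" "(of_nat k :: 'a) \<noteq> 0"
  shows "coeff g k = 0"
proof (cases k)
  case (Suc n)
  have "of_nat (Suc n) * coeff g (Suc n) = coeff (pderiv g) n"
    by (rule coeff_pderiv[symmetric])
  also have "\<dots> = 0" unfolding assms(1) by simp
  finally show ?thesis using assms(2) Suc by auto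
qed (use assms in simp)

lemma of_nat_mod_ring_neq_0:
  assumes "0 < k" "k < CARD('a::prime_card)"
  shows "(of_nat k :: 'a mod_ring) \<noteq> 0"
  using assms of_nat_0_mod_ring_dvd[of k, where ?'a='a] nat_dvd_not_less by blast
lemma pderiv_power_CARD: "pderiv (f ^ CARD('a)) = 0" for f :: "'a::prime_card mod_ring poly" 
  unfolding pderiv_power of_nat_card_eq_0 by (rule smult_0_left)
text \<open>Since \<open>f ^ p\<close> has derivative 0, its coefficients at indices strictly
  between 0 and \<open>p\<close> vanish, so it is constant modulo \<open>X ^ p\<close>.\<close>

lemma power_CARD_minus_const_dvd:
  fixes f :: "'a::prime_card mod_ring poly"
  shows "monom 1 CARD('a) dvd f ^ CARD('a) - [:coeff (f ^ CARD('a)) 0:]"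
  unfolding monom_1_dvd_iff'
proof (intro allI impI)
  fix k assume k: "k < CARD('a)"
  show "coeff (f ^ CARD('a) - [:coeff (f ^ CARD('a)) 0:]) k = 0"
  proof (cases "k = 0")
    case False
    hence "coeff (f ^ CARD('a)) k = 0"
      using coeff_eq_0_if_pderiv_eq_0[OF pderiv_power_CARD of_nat_mod_ring_neq_0] k by blast
    with False show ?thesis by (simp add: coeff_pCons split: nat.split)
  qed simp
qed
text \<open>
  For the least \<open>j\<close> with \<open>(r j, s j) \<noteq> 0\<close> the hypothesis gives \<open>r j + f ^ q * s j \<equiv> 0\<close> modulo \<open>X ^ p\<close>.
  Multiplying by the conjugate and by \<open>f\<close>, and using that \<open>f ^ p\<close> is constant modulo \<open>X ^ p\<close>, one gets
  \<open>(r j)\<^sup>2 f \<equiv> c (s j)\<^sup>2\<close>, which is an equality because the degrees are less than \<open>p\<close>.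
\<close>

lemma stepanov_nonvanishing:
  fixes f :: "'a::prime_card mod_ring poly"
  assumes p: "CARD('a) = 2 * q + 1" and f0: "coeff f 0 \<noteq> 0" and nsq: "nonsquare_poly f"
    and deg: "\<And>j. j < J \<Longrightarrow> 2 * degree (r j) + degree f < CARD('a)"
             "\<And>j. j < J \<Longrightarrow> 2 * degree (s j) < CARD('a)"
    and eq: "(\<Sum>j<J. (r j + f ^ q * s j) * monom 1 (j * CARD('a))) = 0"
    and "j < J"
  shows "r j = 0 \<and> s j = 0"
  using \<open>j < J\<close>
proof (induction j rule: less_induct)
  case (less j)
  let ?p = "CARD('a)"
  let ?t = "\<lambda>j. (r j + f ^ q * s j) * monom 1 (j * ?p)"
  have "(\<Sum>i\<in>{..<J}. ?t i) = ?t j + (\<Sum>i\<in>{..<J}-{j}. ?t i)"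
    using less.prems by (intro sum.remove) auto
  \<comment> \<open>Terms below \<open>j\<close> are 0 by induction, terms above \<open>j\<close>
    contain \<open>X ^ ((j + 1) * p)\<close>.\<close>
  moreover have "monom 1 (Suc j * ?p) dvd (\<Sum>i\<in>{..<J}-{j}. ?t i)"
  proof (intro dvd_sum)
    fix i assume i: "i \<in> {..<J}-{j}"
    show "monom 1 (Suc j * ?p) dvd ?t i"
    proof (cases "i < j")
      case True
      thus ?thesis using less.IH[of i] i by simp
    next
      case False
      with i have "Suc j * ?p \<le> i * ?p" by (intro mult_right_mono) auto
      then obtain e where e: "i * ?p = Suc j * ?p + e" using le_Suc_ex by blast
      have "monom 1 (i * ?p) = monom (1::'a mod_ring) (Suc j * ?p) * monom 1 e"
        unfolding e by (simp add: mult_monom)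
      thus ?thesis by simp
    qed
  qed
  ultimately have "monom 1 (Suc j * ?p) dvd ?t j"
    using eq dvd_add_left_iff[of "monom 1 (Suc j * ?p)" "\<Sum>i\<in>{..<J}-{j}. ?t i" "?t j"] by simp
  moreover have "monom 1 (Suc j * ?p) = monom (1::'a mod_ring) (j * ?p) * monom 1 ?p"
    by (simp add: mult_monom add.commute)
  ultimately have X: "monom 1 ?p dvd r j + f ^ q * s j"
    by (simp add: mult.commute[of "monom 1 (j * ?p)"])
  define c where "c = coeff (f ^ ?p) 0"
  have "c \<noteq> 0" using f0 by (simp add: c_def coeff_0_power)
  have "(r j)\<^sup>2 * f - smult c ((s j)\<^sup>2)
      = (r j + f ^ q * s j) * ((r j - f ^ q * s j) * f) + (s j)\<^sup>2 * (f ^ ?p - [:c:])"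
  proof -
    have "f ^ ?p = f ^ q * f ^ q * f" unfolding p by (simp add: power_add mult_2)
    thus ?thesis by (simp add: algebra_simps power2_eq_square)
  qed
  hence "monom 1 ?p dvd (r j)\<^sup>2 * f - smult c ((s j)\<^sup>2)"
    using X power_CARD_minus_const_dvd[of f] unfolding c_def by simp
  moreover have "degree ((r j)\<^sup>2 * f - smult c ((s j)\<^sup>2)) < ?p"
  proof (rule degree_diff_less)
    show "degree ((r j)\<^sup>2 * f) < ?p"
      using degree_mult_le[of "(r j)\<^sup>2" f] degree_power_le[of "r j" 2] deg(1)[OF less.prems] by simp
    show "degree (smult c ((s j)\<^sup>2)) < ?p"
      using degree_power_le[of "s j" 2] deg(2)[OF less.prems] by (simp add: \<open>c \<noteq> 0\<close>)
  qed
  ultimately have eq2: "(r j)\<^sup>2 * f = smult c ((s j)\<^sup>2)"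
    using divides_degree[of "monom 1 ?p" "(r j)\<^sup>2 * f - smult c ((s j)\<^sup>2)"] by (auto simp: degree_monom_eq)
  hence "r j = 0" using nsq unfolding nonsquare_poly_def by blast
  with eq2 \<open>c \<noteq> 0\<close> show ?case by simp
qed

section \<open>The auxiliary polynomial and its linear conditions\<close>

lemma funpow_pderiv_sum:
  fixes g :: "'b \<Rightarrow> 'a::idom poly"
  shows "(pderiv ^^ k) (\<Sum>j\<in>A. g j) = (\<Sum>j\<in>A. (pderiv ^^ k) (g j))"
  by (induction k) (simp_all add: pderiv_sum)

lemma funpow_pderiv_add:
  fixes g :: "'a::idom poly"
  shows "(pderiv ^^ k) (g + h) = (pderiv ^^ k) g + (pderiv ^^ k) h"
  by (induction k) (simp_all add: pderiv_add)

lemma pderiv_eq_0_monom: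
  assumes "(of_nat n :: 'a::idom) = 0"
  shows "pderiv (monom (1::'a) n) = 0"
  unfolding pderiv_monom assms by simp

text \<open>Powers of \<open>X ^ p\<close> are constants for \<open>pderiv\<close>, and
  \<open>f ^ q\<close> only raises the exponent of \<open>f\<close> from \<open>M\<close> to
  \<open>M + q\<close>. Both can thus be evaluated after differentiation, as \<open>X\<close> and
  \<open>eps\<close>, which leaves a polynomial of low degree times
  \<open>f x ^ (M - k)\<close>.\<close>

lemma stepanov_derivative:
  fixes f :: "'a::idom poly"
  assumes h: "\<And>j. j < J \<Longrightarrow> pderiv (monom (1::'a) (j * p)) = 0" and "k \<le> M"
    and x: "x ^ p = x" "poly f x ^ q = eps"
  shows "poly ((pderiv ^^ k) (f ^ M * (\<Sum>j<J. (r j + f ^ q * s j) * monom 1 (j * p)))) x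
    = poly f x ^ (M - k) * poly (\<Sum>j<J. monom 1 j *
        (pderiv_cofactor f M k (r j) + smult eps (pderiv_cofactor f (M + q) k (s j)))) x"
proof -
  have expand: "f ^ M * (\<Sum>j<J. (r j + f ^ q * s j) * monom 1 (j * p))
      = (\<Sum>j<J. f ^ M * r j * monom 1 (j * p) + f ^ (M + q) * s j * monom 1 (j * p))"
    by (simp add: sum_distrib_left algebra_simps power_add)
  have derivs: "(pderiv ^^ k) (\<Sum>j<J. f ^ M * r j * monom 1 (j * p) + f ^ (M + q) * s j * monom 1 (j * p))
      = (\<Sum>j<J. f ^ (M - k) * pderiv_cofactor f M k (r j) * monom 1 (j * p)
      + f ^ (M + q - k) * pderiv_cofactor f (M + q) k (s j) * monom 1 (j * p))"
    unfolding funpow_pderiv_sum funpow_pderiv_add using assms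
    by (intro sum.cong refl arg_cong2[of _ _ _ _ "(+)"] funpow_pderiv_power_mult) auto
  show ?thesis
    unfolding expand derivs unfolding poly_sum sum_distrib_left
  proof (intro sum.cong refl)
    fix j
    have "x ^ (j * p) = x ^ j" unfolding mult.commute[of j p] power_mult x(1) ..
    moreover have "poly f x ^ (M + q - k) = poly f x ^ (M - k) * eps"
      using \<open>k \<le> M\<close> unfolding x(2)[symmetric] power_add[symmetric] by simp
    ultimately show "poly (f ^ (M - k) * pderiv_cofactor f M k (r j) * monom 1 (j * p) +
          f ^ (M + q - k) * pderiv_cofactor f (M + q) k (s j) * monom 1 (j * p)) x =
        poly f x ^ (M - k) * poly (monom 1 j *
          (pderiv_cofactor f M k (r j) + smult eps (pderiv_cofactor f (M + q) k (s j)))) x"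
      by (simp add: poly_monom algebra_simps)
  qed
qed

text \<open>The bound is free of \<open>q\<close>, so each derivative imposes few linear conditions
  although the auxiliary polynomial itself has large degree.\<close>

lemma degree_stepanov_conditions:
  fixes f :: "'a::idom poly"
  assumes "\<And>j. j < J \<Longrightarrow> degree (r j) \<le> B" "\<And>j. j < J \<Longrightarrow> degree (s j) \<le> B" "k < M" "M * degree f + B + J \<le> t"
  shows "coeff (\<Sum>j<J. monom 1 j *
        (pderiv_cofactor f M k (r j) + smult eps (pderiv_cofactor f (M + q) k (s j)))) t = 0"
proof -
  have "coeff (monom 1 j *
        (pderiv_cofactor f M k (r j) + smult eps (pderiv_cofactor f (M + q) k (s j)))) t = 0" if "j < J" for j
  proof (rule coeff_eq_0)
    have "k * degree f \<le> M * degree f" using \<open>k < M\<close> by simp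
    hence "degree (pderiv_cofactor f c k u) \<le> B + M * degree f" if "degree u \<le> B" for u c
      using that degree_pderiv_cofactor[of f c k u] by linarith
    hence "degree (pderiv_cofactor f M k (r j) + smult eps (pderiv_cofactor f (M + q) k (s j)))
        \<le> B + M * degree f"
      using assms(1,2)[OF \<open>j < J\<close>] by (intro degree_add_le order_trans[OF degree_smult_le]) auto
    moreover have "degree (monom (1::'a) j) = j" by (simp add: degree_monom_eq)
    ultimately show "degree (monom 1 j *
        (pderiv_cofactor f M k (r j) + smult eps (pderiv_cofactor f (M + q) k (s j)))) < t"
      using degree_mult_le[of "monom (1::'a) j" "pderiv_cofactor f M k (r j) + smult eps (pderiv_cofactor f (M + q) k (s j))"]
        \<open>j < J\<close> assms(4) by linarith
  qed
  thus ?thesis unfolding coeff_sum by (intro sum.neutral) auto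
qed

text \<open>
  The unknowns are the coefficients of the polynomials \<open>r j\<close> and \<open>s j\<close>, the equations are the
  coefficients of the derivatives of order less than \<open>M\<close> after \<open>f ^ q\<close> and \<open>X ^ p\<close> have been replaced
  by their values \<open>eps\<close> and \<open>X\<close>; the hypothesis says that there are more unknowns than equations.
\<close>

lemma exists_stepanov_coefficients:
  fixes f :: "'a::{finite,idom} poly"
  assumes "M * (Suc B + M * degree f + J) < 2 * J * Suc B"
  obtains r s where "\<And>j. degree (r j) \<le> B" "\<And>j. degree (s j) \<le> B" "\<exists>j<J. r j \<noteq> 0 \<or> s j \<noteq> 0"
    "\<And>k. k < M \<Longrightarrow> (\<Sum>j<J. monom 1 j *
        (pderiv_cofactor f M k (r j) + smult eps (pderiv_cofactor f (M + q) k (s j)))) = 0"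
proof -
  define P :: "bool \<Rightarrow> (bool \<times> nat \<times> nat \<Rightarrow> 'a) \<Rightarrow> nat \<Rightarrow> 'a poly"
    where "P = (\<lambda>b v j. \<Sum>i\<le>B. monom (v (b, j, i)) i)"
  define W where "W = (\<lambda>k v. \<Sum>j<J. monom 1 j *
        (pderiv_cofactor f M k (P True v j) + smult eps (pderiv_cofactor f (M + q) k (P False v j))))"
  let ?E = "{..<M} \<times> {..<Suc B + M * degree f + J}"
  let ?I = "(UNIV :: bool set) \<times> {..<J} \<times> {..B}"
  have Pdiff: "P b (\<lambda>i. v i - w i) j = P b v j - P b w j" for b v w j
    unfolding P_def by (simp flip: sum_subtractf diff_monom)
  have Wdiff: "W k (\<lambda>i. v i - w i) = W k v - W k w" for k v w
    unfolding W_def Pdiff pderiv_cofactor_diff sum_subtractf[symmetric]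
    by (intro sum.cong refl) (simp add: algebra_simps smult_diff_right)
  have "card ?E < card ?I" using assms by (simp add: card_cartesian_product)
  then obtain v where v: "\<exists>i\<in>?I. v i \<noteq> 0" "\<And>e. e \<in> ?E \<Longrightarrow> coeff (W (fst e) v) (snd e) = 0"
    by (rule exists_nonzero_kernel_vector[of ?E ?I "\<lambda>e v. coeff (W (fst e) v) (snd e)", rotated 2])
       (simp_all add: Wdiff)
  have degP: "degree (P b v j) \<le> B" for b j
    unfolding P_def by (intro degree_sum_le) (auto intro: order_trans[OF degree_monom_le])
  have coeffP: "coeff (P b v j) i = v (b, j, i)" if "i \<le> B" for b j i
    unfolding P_def coeff_sum coeff_monom using that by simp
  show thesis
  proof
    obtain b j i where bji: "j < J" "i \<le> B" "v (b, j, i) \<noteq> 0" using v(1) by auto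
    hence "coeff (P b v j) i \<noteq> 0" using coeffP by simp
    hence "P b v j \<noteq> 0" by auto
    thus "\<exists>j<J. P True v j \<noteq> 0 \<or> P False v j \<noteq> 0" using bji by (cases b) auto
    show "(\<Sum>j<J. monom 1 j *
        (pderiv_cofactor f M k (P True v j) + smult eps (pderiv_cofactor f (M + q) k (P False v j)))) = 0"
      if "k < M" for k
    proof (rule poly_eqI)
      fix t
      show "coeff (\<Sum>j<J. monom 1 j * (pderiv_cofactor f M k (P True v j) +
          smult eps (pderiv_cofactor f (M + q) k (P False v j)))) t = coeff 0 t"
      proof (cases "t < Suc B + M * degree f + J")
        case True
        with v(2)[of "(k, t)"] that show ?thesis by (simp add: W_def)
      next
        case False
        have "coeff (\<Sum>j<J. monom 1 j * (pderiv_cofactor f M k (P True v j) +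
            smult eps (pderiv_cofactor f (M + q) k (P False v j)))) t = 0"
          by (rule degree_stepanov_conditions[where B = B]) (use False that degP in auto)
        thus ?thesis by simp
      qed
    qed
  qed (use degP in auto)
qed

text \<open>The polynomial \<open>f ^ M * S\<close> is nonzero and vanishes to order at least
  \<open>M\<close> at every counted \<open>x\<close>, so its degree bounds \<open>M\<close> times
  the count. The factor \<open>f ^ M\<close> supplies the powers of \<open>f\<close> consumed by the
  derivatives.\<close>

lemma stepanov_count:
  fixes f :: "'a::prime_card mod_ring poly"
  assumes p: "CARD('a) = 2 * q + 1" and f0: "coeff f 0 \<noteq> 0" and nsq: "nonsquare_poly f"
    and "2 * B + degree f < CARD('a)" "M \<le> CARD('a)"
    and cond: "M * (Suc B + M * degree f + J) < 2 * J * Suc B"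
  shows "card {x. poly f x ^ q = eps} * M \<le> M * degree f + B + q * degree f + (J - 1) * CARD('a)"
proof -
  obtain r s where rs: "\<And>j. degree (r j) \<le> B" "\<And>j. degree (s j) \<le> B" "\<exists>j<J. r j \<noteq> 0 \<or> s j \<noteq> 0"
    "\<And>k. k < M \<Longrightarrow> (\<Sum>j<J. monom 1 j *
        (pderiv_cofactor f M k (r j) + smult eps (pderiv_cofactor f (M + q) k (s j)))) = 0"
    by (rule exists_stepanov_coefficients[OF cond, where q = q and eps = eps])
       (rule that)
  define S where "S = (\<Sum>j<J. (r j + f ^ q * s j) * monom 1 (j * CARD('a)))"
  have "S \<noteq> 0"
  proof
    assume "S = 0"
    obtain j where j: "j < J" "r j \<noteq> 0 \<or> s j \<noteq> 0" using rs(3) by auto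
    have "r j = 0 \<and> s j = 0"
    proof (rule stepanov_nonvanishing[OF p f0 nsq _ _ _ j(1)])
      show "2 * degree (r i) + degree f < CARD('a)" for i using rs(1)[of i] assms(4) by linarith
      show "2 * degree (s i) < CARD('a)" for i using rs(2)[of i] assms(4) by linarith
    qed (use \<open>S = 0\<close> in \<open>simp only: S_def\<close>)
    with j show False by blast
  qed
  moreover have "f \<noteq> 0" using f0 by auto
  ultimately have nz: "f ^ M * S \<noteq> 0" by simp
  have "[:-x, 1:] ^ M dvd f ^ M * S" if x: "poly f x ^ q = eps" for x
  proof (rule power_dvd_if_pderivs_vanish)
    fix k assume "k < M"
    have h: "pderiv (monom (1::'a mod_ring) (j * CARD('a))) = 0" for j
      by (rule pderiv_eq_0_monom) (simp only: of_nat_mult of_nat_card_eq_0 mult_zero_right)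
    have "x ^ CARD('a) = x"
      using finite_field_power_card_eq_same[of x] by (simp only: CARD_mod_ring)
    have "poly ((pderiv ^^ k) (f ^ M * S)) x = poly f x ^ (M - k) * poly 0 x"
      unfolding S_def rs(4)[OF \<open>k < M\<close>, symmetric]
      by (rule stepanov_derivative[OF h]) (use \<open>k < M\<close> \<open>x ^ CARD('a) = x\<close> x in simp_all)
    thus "poly ((pderiv ^^ k) (f ^ M * S)) x = 0" by simp
  next
    fix k assume "0 < k" "k < M"
    thus "(of_nat k :: 'a mod_ring) \<noteq> 0" using assms(5) of_nat_mod_ring_neq_0[of k, where ?'a='a] by linarith
  qed
  hence "card {x. poly f x ^ q = eps} * M \<le> degree (f ^ M * S)"
    by (intro card_mult_le_degree_if_power_dvd[OF nz]) auto
  also have "\<dots> \<le> M * degree f + degree S"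
    using degree_mult_le[of "f ^ M" S] degree_power_le[of f M] by (simp add: mult.commute)
  also have "degree S \<le> B + q * degree f + (J - 1) * CARD('a)"
    unfolding S_def
  proof (intro degree_sum_le)
    fix j assume "j \<in> {..<J}"
    hence "j * CARD('a) \<le> (J - 1) * CARD('a)" by (intro mult_right_mono) auto
    moreover have "degree (f ^ q * s j) \<le> q * degree f + B"
      using degree_mult_le[of "f ^ q" "s j"] degree_power_le[of f q] rs(2)[of j]
      by (metis add_mono mult.commute order_trans)
    hence "degree (r j + f ^ q * s j) \<le> B + q * degree f"
      using rs(1)[of j] by (intro degree_add_le) auto
    ultimately show "degree ((r j + f ^ q * s j) * monom 1 (j * CARD('a)))
        \<le> B + q * degree f + (J - 1) * CARD('a)"
      using degree_mult_le[of "r j + f ^ q * s j" "monom 1 (j * CARD('a))"]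
        degree_monom_le[of "1 :: 'a mod_ring" "j * CARD('a)"] by linarith
  qed simp
  finally show ?thesis by simp
qed

text \<open>
  The choice is \<open>M = 2 K\<close> just below \<open>sqrt p\<close>, \<open>J = K + 2 D\<close>, and \<open>B\<close> just below \<open>(p - D) / 2\<close>.
\<close>

lemma stepanov_parameters:
  fixes p D q :: nat
  assumes p: "p = 2 * q + 1" "p \<ge> 1024" and D: "0 < D" "16 * D \<le> p"
  obtains M J B where "2 * B + D < p" "M \<le> p" "0 < M" "M * (Suc B + M * D + J) < 2 * J * Suc B"
    "\<And>N. N * M \<le> M * D + B + q * D + (J - 1) * p \<Longrightarrow> real N \<le> p / 2 + 4 * D * sqrt p"
proof -
  define s where "s = sqrt (real p)"
  have s2: "s * s = p" by (simp add: s_def)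
  have s32: "s \<ge> 32" using p(2) unfolding s_def by (intro real_le_rsqrt) simp
  define K where "K = nat \<lfloor>s / 2\<rfloor>"
  define M where "M = 2 * K"
  define J where "J = K + 2 * D"
  define B where "B = (p - D - 1) div 2"
  have K: "real K \<le> s / 2" "real K > s / 2 - 1" using s32 unfolding K_def by linarith+
  hence M: "real M \<le> s" "real M \<ge> 15 / 16 * s" using s32 unfolding M_def by simp_all
  have "real M * real M \<le> s * s" using M s32 by (intro mult_mono) auto
  hence MM: "M * M \<le> p" unfolding s2 by (metis of_nat_le_iff of_nat_mult)
  have "32 * real M \<le> s * s" using M s32 mult_mono[of 32 s "real M" s] by simp
  hence M32: "32 * M \<le> p" unfolding s2 by linarith
  have B: "2 * Suc B \<ge> p - D" "2 * B + D < p" proof -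
    have "p - D - 1 \<le> 2 * B + 1" "2 * B \<le> p - D - 1" unfolding B_def by simp_all
    thus "2 * Suc B \<ge> p - D" "2 * B + D < p" using p D by presburger+
  qed
  \<comment> \<open>After \<open>M * Suc B\<close> cancels, the summand \<open>2 * D\<close> of
    \<open>J\<close> leaves \<open>4 * (D * Suc B)\<close>, at least \<open>2 * D * (p - D)\<close>.
    This exceeds \<open>M * M * D \<le> p * D\<close> together with the smaller terms.\<close>
  have cond: "M * (Suc B + M * D + J) < 2 * J * Suc B"
  proof -
    have "M * M * D \<le> p * D" using MM by simp
    moreover have "2 * (M * K) \<le> p" using MM by (simp add: M_def)
    moreover have "p \<le> p * D" using D by simp
    moreover have "32 * (M * D) \<le> p * D" using mult_right_mono[OF M32, of D] by simp
    moreover have "16 * (D * D) \<le> p * D" using mult_right_mono[OF D(2), of D] by simp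
    moreover have "D * p \<le> D * (2 * Suc B + D)" using B(1) by (intro mult_left_mono) auto
    moreover have "p * D > 0" using p D by simp
    moreover have "M * (Suc B + M * D + J) = M * Suc B + M * M * D + M * K + 2 * (M * D)"
      by (simp add: J_def algebra_simps)
    moreover have "2 * J * Suc B = M * Suc B + 4 * (D * Suc B)"
      by (simp add: J_def M_def algebra_simps)
    moreover have "D * (2 * Suc B + D) = 2 * (D * Suc B) + D * D" by (simp add: algebra_simps)
    moreover have "p * D = D * p" by simp
    ultimately show ?thesis by linarith
  qed
  show thesis
  proof
    fix N assume N: "N * M \<le> M * D + B + q * D + (J - 1) * p"
    have "real (N * M) \<le> real (M * D + B + q * D + (J - 1) * p)" using N by (subst of_nat_le_iff)
    hence 1: "real N * M \<le> real M * D + B + real q * D + (real J - 1) * p"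
      using D by (simp add: J_def of_nat_diff)
    have 2: "(real J - 1) * p = real M * (p / 2) + 2 * (real D * p) - p"
      by (simp add: J_def M_def algebra_simps)
    have 3: "real q * D \<le> (real D * p) / 2" using p D by simp
    \<comment> \<open>Beyond \<open>M * (p / 2)\<close> there remain \<open>2 * D * p\<close> from
      \<open>J\<close> and \<open>D * p / 2\<close> from \<open>q * D\<close>; the term
      \<open>- p\<close> absorbs \<open>B\<close>.\<close>
    have "5 / 2 * (D * real p) \<le> 15 / 16 * s * (3 * D * s)" using D s32 by (simp add: s2[symmetric])
    also have "\<dots> \<le> real M * (3 * D * s)" using M D s32 by (intro mult_right_mono) auto
    finally have "real M * N \<le> real M * (p / 2) + real M * D + real M * (3 * D * s)"
      using 1 2 3 B(2) by (simp add: mult.commute[of "real N"])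
    hence "real M * N \<le> real M * (p / 2 + D + 3 * D * s)" by (simp only: distrib_left)
    hence "real N \<le> p / 2 + D + 3 * D * s" using M s32 by (subst (asm) mult_le_cancel_left_pos) auto
    moreover have "real D \<le> D * s" using s32 D by simp
    ultimately show "real N \<le> p / 2 + 4 * D * sqrt p" by (simp add: s_def)
  qed (use B cond M s32 M32 in auto)
qed

lemma nonsquare_poly_pcompose:
  fixes f :: "'a::idom poly"
  assumes "nonsquare_poly f"
  shows "nonsquare_poly (pcompose f [:a, 1:])"
  unfolding nonsquare_poly_def
proof (intro allI impI)
  fix c r s assume eq: "r\<^sup>2 * pcompose f [:a, 1:] = smult c (s\<^sup>2)"
  let ?c = "\<lambda>g. pcompose g [:-a, 1:]"
  have "pcompose [:a, 1:] [:-a, 1:] = [:0, 1:]" by (simp add: pcompose_pCons)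
  hence inv: "?c (pcompose g [:a, 1:]) = g" for g :: "'a poly"
    by (simp only: pcompose_assoc[symmetric] pcompose_idR)
  from arg_cong[OF eq, of ?c] have "(?c r)\<^sup>2 * f = smult c ((?c s)\<^sup>2)"
    by (simp only: pcompose_mult inv power2_eq_square pcompose_smult)
  hence "?c r = 0" using assms unfolding nonsquare_poly_def by blast
  moreover have "degree [:-a, 1:] > 0" by simp
  ultimately show "r = 0" using pcompose_eq_0 by blast
qed

lemma degree_pos_if_nonsquare_poly:
  fixes f :: "'a::idom poly"
  assumes "nonsquare_poly f"
  shows "degree f > 0"
proof (rule ccontr)
  assume "\<not> degree f > 0"
  then obtain c where "f = [:c:]" by (auto elim: degree_eq_zeroE)
  hence "1\<^sup>2 * f = smult c (1\<^sup>2)" by simp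
  with assms show False unfolding nonsquare_poly_def by (metis one_neq_zero)
qed

text \<open>Stepanov's count asks for a nonzero constant term. As \<open>f\<close> has fewer zeros
  than the field has elements, some translate has one, and translation changes neither the count nor
  the degree nor the nonsquare property.\<close>

lemma card_power_eq_le:
  fixes f :: "'a::prime_card mod_ring poly"
  assumes p: "CARD('a) = 2 * q + 1" "CARD('a) \<ge> 1024"
    and "nonsquare_poly f" "16 * degree f \<le> CARD('a)"
  shows "real (card {x. poly f x ^ q = eps}) \<le> CARD('a) / 2 + 4 * degree f * sqrt CARD('a)"
proof -
  have D: "degree f > 0" by (rule degree_pos_if_nonsquare_poly) fact
  have "card {x. poly f x = 0} \<le> degree f" using D by (intro card_poly_roots_bound) auto
  also have "\<dots> < card (UNIV :: 'a mod_ring set)" using D assms(4) unfolding CARD_mod_ring by linarith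
  finally have "{x. poly f x = 0} \<noteq> UNIV" by auto
  then obtain a where a: "poly f a \<noteq> 0" by auto
  define g where "g = pcompose f [:a, 1:]"
  have g: "coeff g 0 \<noteq> 0" "nonsquare_poly g" "degree g = degree f"
    using a nonsquare_poly_pcompose[OF assms(3)]
    by (simp_all add: g_def degree_pcompose poly_pcompose flip: poly_0_coeff_0)
  have "{x. poly f x ^ q = eps} = (\<lambda>x. a + x) ` {x. poly g x ^ q = eps}"
    by (auto simp: g_def poly_pcompose image_iff intro!: exI[of _ "_ - a"])
  hence card_eq: "card {x. poly f x ^ q = eps} = card {x. poly g x ^ q = eps}"
    by (simp add: card_image)
  obtain M J B where MJB: "2 * B + degree f < CARD('a)" "M \<le> CARD('a)" "0 < M"
      "M * (Suc B + M * degree f + J) < 2 * J * Suc B"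
    "\<And>N. N * M \<le> M * degree f + B + q * degree f + (J - 1) * CARD('a) \<Longrightarrow>
      real N \<le> CARD('a) / 2 + 4 * degree f * sqrt CARD('a)"
    by (rule stepanov_parameters[OF p D assms(4)]) (rule that)
  show ?thesis
    unfolding card_eq
    by (rule MJB(5), rule stepanov_count[OF p(1) g(1,2), unfolded g(3)]) (rule MJB)+
qed

subsection \<open>Products of shifts of a square-free polynomial\<close>

definition pshift :: "'a::comm_ring_1 \<Rightarrow> 'a poly \<Rightarrow> 'a poly" where
  "pshift a g = pcompose g [:a, 1:]"

lemma pshift_pshift [simp]: "pshift a (pshift b g) = pshift (a + b) g"
proof -
  have "pcompose [:b, 1:] [:a, 1:] = [:a + b, 1:]" by (simp add: pcompose_pCons add.commute)
  thus ?thesis by (simp only: pcompose_assoc[symmetric] pshift_def)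
qed

lemma pshift_0_left [simp]: "pshift 0 g = g"
  by (simp only: pshift_def pcompose_idR)

lemma pshift_1_right [simp]: "pshift a 1 = 1"
  by (simp only: pshift_def pcompose_1)

lemma pshift_mult: "pshift a (g * h) = pshift a g * pshift a h"
  by (simp only: pshift_def pcompose_mult)

lemma poly_pshift [simp]: "poly (pshift a g) x = poly g (a + x)"
  by (simp add: pshift_def poly_pcompose)

lemma degree_pshift [simp]: "degree (pshift a g) = degree (g :: 'a::idom poly)"
  by (simp add: pshift_def degree_pcompose)

lemma pshift_eq_0_iff [simp]: "pshift a g = 0 \<longleftrightarrow> g = (0 :: 'a::idom poly)"
  using pcompose_eq_0[of g "[:a, 1:]"] by (auto simp: pshift_def)

lemma lead_coeff_pshift: "lead_coeff (pshift a g) = lead_coeff (g :: 'a::idom poly)"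
proof -
  have "lead_coeff (pcompose g [:a, 1:]) = lead_coeff g * lead_coeff [:a, 1:] ^ degree g"
    by (rule lead_coeff_comp) simp
  thus ?thesis by (simp add: pshift_def)
qed

lemma pshift_dvd_iff:
  fixes g :: "'a::comm_ring_1 poly"
  shows "pshift a g dvd pshift b h \<longleftrightarrow> pshift (a - b) g dvd h"
proof
  have mono: "pshift c u dvd pshift c v" if "u dvd v" for c and u v :: "'a poly"
    using that by (auto simp: pshift_mult elim!: dvdE)
  show "pshift (a - b) g dvd h" if "pshift a g dvd pshift b h"
    using mono[OF that, of "-b"] by simp
  show "pshift a g dvd pshift b h" if "pshift (a - b) g dvd h"
    using mono[OF that, of b] by simp
qed

lemma prime_elem_pshift:
  fixes g :: "'a::idom poly"
  assumes "prime_elem g"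
  shows "prime_elem (pshift a g)"
proof (rule prime_elemI)
  have adj: "pshift a g dvd w \<longleftrightarrow> g dvd pshift (-a) w" for w
    using pshift_dvd_iff[of a g 0 w] pshift_dvd_iff[of 0 g "-a" w] by simp
  show "pshift a g \<noteq> 0" using assms by auto
  show "\<not> pshift a g dvd 1" using assms by (simp add: adj prime_elem_def)
  show "pshift a g dvd u \<or> pshift a g dvd v" if "pshift a g dvd u * v" for u v
    using that prime_elem_dvd_multD[OF assms] unfolding adj pshift_mult by blast
qed

text \<open>
  Otherwise \<open>P\<close> is invariant under translation by \<open>t \<noteq> 0\<close>, so \<open>P - P 0\<close> vanishes at all multiples of
  \<open>t\<close>, which are all elements of the field.
\<close>

lemma pshift_dvd_self_imp_0:
  fixes P :: "'a::{field,finite} poly"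
  assumes "pshift t P dvd P" and surj: "\<And>x :: 'a. \<exists>k. x = of_nat k"
    and deg: "0 < degree P" "degree P < CARD('a)"
  shows "t = 0"
proof (rule ccontr)
  assume t: "t \<noteq> 0"
  obtain u where u: "P = pshift t P * u" using assms(1) by (elim dvdE)
  have nz: "P \<noteq> 0" "u \<noteq> 0" "pshift t P \<noteq> 0" using deg u by auto
  have "degree P = degree P + degree u"
    using nz by (subst u, subst degree_mult_eq) simp_all
  then obtain c where c: "u = [:c:]" by (auto elim: degree_eq_zeroE)
  have "lead_coeff P = lead_coeff (pshift t P * u)" by (rule arg_cong[OF u, of "\<lambda>p. lead_coeff p"])
  hence "lead_coeff P = lead_coeff P * c" unfolding lead_coeff_mult lead_coeff_pshift c by simp
  hence "c = 1" using nz by simp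
  hence per: "P = pshift t P" using u c by simp
  have "poly P (t + x) = poly P x" for x
    by (subst (2) per) simp
  hence k: "poly P (of_nat k * t) = poly P 0" for k
    by (induction k) (simp_all add: distrib_right)
  have "poly (P - [:poly P 0:]) x = 0" for x
  proof -
    obtain k where "x / t = of_nat k" using surj by blast
    hence "x = of_nat k * t" using t by (simp add: field_simps)
    thus ?thesis using k by simp
  qed
  hence "{x. poly (P - [:poly P 0:]) x = 0} = UNIV" by simp
  moreover have dP: "degree (P - [:poly P 0:]) = degree P"
    using deg degree_add_eq_left[of "- [:poly P 0:]" P] by (simp only: diff_conv_add_uminus degree_minus degree_pCons_0)
  moreover have "P - [:poly P 0:] \<noteq> 0" using dP deg by auto
  ultimately have "CARD('a) \<le> degree P" using card_poly_roots_bound[of "P - [:poly P 0:]"] by simp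
  thus False using deg by simp
qed

section \<open>Prime factors of translates and their multiplicities\<close>

lemma prime_elem_dvd_prodD:
  assumes "prime_elem p" "finite B" "p dvd prod f B"
  shows "\<exists>b\<in>B. p dvd f b"
  using assms(2,3)
proof (induction B)
  case empty
  thus ?case using assms(1) unfolding prime_elem_def by simp
next
  case (insert b B)
  from insert.prems have "p dvd f b * prod f B" unfolding prod.insert[OF insert.hyps] .
  hence "p dvd f b \<or> p dvd prod f B" by (rule prime_elem_dvd_multD[OF assms(1)])
  thus ?case using insert.IH by blast
qed

lemma prod_dvd_if_prime_elems_dvd:
  fixes f :: "'b \<Rightarrow> 'a::idom"
  assumes "finite B" "\<And>b. b \<in> B \<Longrightarrow> prime_elem (f b)" "\<And>b. b \<in> B \<Longrightarrow> f b dvd F"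
    and "\<And>a b. a \<in> B \<Longrightarrow> b \<in> B \<Longrightarrow> f a dvd f b \<Longrightarrow> a = b"
  shows "prod f B dvd F"
  using assms
proof (induction B)
  case (insert b B)
  have "prod f B dvd F"
  proof (rule insert.IH)
    show "prime_elem (f c)" "f c dvd F" if "c \<in> B" for c using insert.prems(1,2) that by simp_all
    show "a = c" if "a \<in> B" "c \<in> B" "f a dvd f c" for a c
      by (rule insert.prems(3)) (use that in simp_all)
  qed
  then obtain G where G: "F = prod f B * G" by (rule dvdE)
  have prm: "prime_elem (f b)" by (rule insert.prems(1)) simp
  have "\<not> f b dvd prod f B"
  proof
    assume "f b dvd prod f B"
    then obtain a where "a \<in> B" "f b dvd f a"
      using prime_elem_dvd_prodD[OF prm insert.hyps(1)] by blast
    with insert.prems(3)[of b a] insert.hyps(2) show False by blast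
  qed
  moreover have "f b dvd prod f B * G" using insert.prems(2)[of b] unfolding G by blast
  ultimately have "f b dvd G" using prime_elem_dvd_multD[OF prm] by blast
  thus ?case unfolding G prod.insert[OF insert.hyps] mult.commute[of "f b"]
    by (intro mult_dvd_mono dvd_refl)
qed simp

text \<open>By \<open>pshift_dvd_self_imp_0\<close> no translate of \<open>P\<close> divides a
  different one, so the product of all translates dividing \<open>F\<close> divides
  \<open>F\<close>, and each contributes at least 1 to the degree.\<close>

lemma card_pshift_factors_le:
  fixes P :: "'a::{field,finite} poly"
  assumes "prime_elem P" "F \<noteq> 0" "\<And>x :: 'a. \<exists>k. x = of_nat k" "0 < degree P" "degree P < CARD('a)"
  shows "card {a. pshift a P dvd F} \<le> degree F"
proof -
  let ?A = "{a. pshift a P dvd F}"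
  have "(\<Prod>a\<in>?A. pshift a P) dvd F"
  proof (rule prod_dvd_if_prime_elems_dvd)
    fix a b assume "pshift a P dvd pshift b P"
    hence "pshift (a - b) P dvd P" by (simp only: pshift_dvd_iff)
    hence "a - b = 0" by (rule pshift_dvd_self_imp_0) (use assms in auto)
    thus "a = b" by simp
  next
    show "prime_elem (pshift a P)" for a by (rule prime_elem_pshift) fact
  qed auto
  hence "degree (\<Prod>a\<in>?A. pshift a P) \<le> degree F" by (rule dvd_imp_degree_le) fact
  moreover have "degree (\<Prod>a\<in>?A. pshift a P) = (\<Sum>a\<in>?A. degree (pshift a P))"
    using assms(4) by (intro degree_prod_eq_sum_degree) auto
  hence "degree (\<Prod>a\<in>?A. pshift a P) = card ?A * degree P" by simp
  moreover have "card ?A \<le> card ?A * degree P" using assms(4) by simp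
  ultimately show ?thesis by linarith
qed

text \<open>
  The set \<open>A + {..<h}\<close> misses some \<open>x\<close>; the last element \<open>a\<close> of \<open>A\<close> before \<open>x\<close> is followed by a gap of
  length at least \<open>h\<close>, so that \<open>a + Max S\<close> has only one representation.
\<close>

lemma exists_unique_representation:
  fixes A :: "'a::{comm_ring_1,finite} set"
  assumes "A \<noteq> {}" "S \<noteq> {}" "S \<subseteq> {..<h}" "card A * h < CARD('a)"
    and surj: "\<And>x :: 'a. \<exists>k. x = of_nat k"
  obtains t i where "i \<in> S" "t - of_nat i \<in> A" "\<And>j. j \<in> S \<Longrightarrow> t - of_nat j \<in> A \<Longrightarrow> j = i"
proof -
  let ?C = "(\<lambda>(a, j). a + of_nat j) ` (A \<times> {..<h})"
  have "card ?C \<le> card A * h"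
    using card_image_le[of "A \<times> {..<h}" "\<lambda>(a, j). a + of_nat j"] by (simp add: card_cartesian_product)
  hence "?C \<noteq> UNIV" using assms(4) by force
  then obtain x where x: "x \<notin> ?C" by auto
  obtain a where "a \<in> A" using assms(1) by auto
  moreover obtain k where "x - a = of_nat k" using surj by blast
  ultimately have ex: "x - of_nat k \<in> A" by (simp add: algebra_simps)
  define k where "k = (LEAST k. x - of_nat k \<in> A)"
  have kA: "x - of_nat k \<in> A" unfolding k_def by (rule LeastI) fact
  have min: "k \<le> j" if "x - of_nat j \<in> A" for j unfolding k_def by (rule Least_le) fact
  have "k \<ge> h"
  proof (rule ccontr)
    assume "\<not> k \<ge> h"
    hence "(\<lambda>(a, j). a + of_nat j) (x - of_nat k, k) \<in> ?C" using kA by (intro imageI) auto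
    with x show False by simp
  qed
  have fin: "finite S" using assms(3) finite_subset by blast
  let ?i = "Max S"
  have iS: "?i \<in> S" using fin assms(2) by (rule Max_in)
  show thesis
  proof
    show "?i \<in> S" by fact
    show "x - of_nat k + of_nat ?i - of_nat ?i \<in> A" using kA by simp
    fix j assume j: "j \<in> S" "x - of_nat k + of_nat ?i - of_nat j \<in> A"
    have le: "j \<le> ?i" using fin j(1) by simp
    have "?i < h" using iS assms(3) by auto
    obtain e where e: "?i = j + e" using le_Suc_ex[OF le] by blast
    with \<open>?i < h\<close> \<open>k \<ge> h\<close> have "e \<le> k" by linarith
    then obtain k' where k': "k = e + k'" using le_Suc_ex by blast
    \<comment> \<open>A representation with smaller \<open>j\<close> would give an element of
      \<open>A\<close> only \<open>k - e\<close> steps before \<open>x\<close>, so minimality of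
      \<open>k\<close> forces \<open>e = 0\<close>.\<close>
    have "x - of_nat k' \<in> A" using j(2) unfolding e k' by (simp add: algebra_simps)
    from min[OF this] show "j = ?i" using k' e by linarith
  qed
qed

text \<open>Comparing multiplicities of \<open>P\<close> in
  \<open>r\<^sup>2 * f = smult c (s\<^sup>2)\<close> gives an odd number on the left and an even one
  on the right.\<close>

lemma nonsquare_polyI:
  fixes f :: "'a::field_gcd poly"
  assumes "prime_elem P" "f \<noteq> 0" "odd (multiplicity P f)"
  shows "nonsquare_poly f"
  unfolding nonsquare_poly_def
proof (intro allI impI, rule ccontr)
  fix c r s assume eq: "r\<^sup>2 * f = smult c (s\<^sup>2)" and "r \<noteq> 0"
  have "smult c (s\<^sup>2) \<noteq> 0" unfolding eq[symmetric] using assms(2) \<open>r \<noteq> 0\<close> by simp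
  hence c: "c \<noteq> 0" "s \<noteq> 0" by auto
  have "multiplicity P ([:c:] * s\<^sup>2) = multiplicity P (s\<^sup>2)"
    using c by (intro multiplicity_times_unit_right) (simp add: is_unit_const_poly_iff)
  hence "2 * multiplicity P r + multiplicity P f = 2 * multiplicity P s"
    using arg_cong[OF eq, of "multiplicity P"] assms c \<open>r \<noteq> 0\<close>
    by (simp add: prime_elem_multiplicity_mult_distrib prime_elem_multiplicity_power_distrib)
  thus False using assms(3) by presburger
qed

text \<open>Fix a prime factor \<open>P\<close> of \<open>F\<close> and let \<open>A\<close> be the
  set of \<open>a\<close> such that \<open>pshift a P\<close> divides \<open>F\<close>. By
  square-freeness \<open>pshift t P\<close> has multiplicity 1 in the factor of index
  \<open>j\<close> if \<open>t - j\<close> is in \<open>A\<close>, and 0 otherwise. A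
  \<open>t\<close> with a unique representation therefore gives total multiplicity 1.\<close>

lemma nonsquare_poly_prod_pshift:
  fixes F :: "'a::{field_gcd,finite} poly"
  assumes sf: "square_free F" and "0 < degree F" "S \<noteq> {}" "S \<subseteq> {..<h}" "degree F * h < CARD('a)"
    and surj: "\<And>x :: 'a. \<exists>k. x = of_nat k"
  shows "nonsquare_poly (\<Prod>i\<in>S. pshift (of_nat i) F)"
proof -
  have F: "F \<noteq> 0" "\<not> is_unit F" using assms(2) by (auto simp: is_unit_iff_degree)
  obtain P where P: "prime_elem P" "P dvd F"
    using prime_divisor_exists[OF F] prime_imp_prime_elem by blast
  have "h > 0" using assms(3,4) by auto
  have "degree F \<le> degree F * h" using \<open>h > 0\<close> by simp
  have degP: "0 < degree P" "degree P < CARD('a)"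
    using P(1) is_unit_iff_degree[of P] dvd_imp_degree_le[OF P(2) F(1)]
      \<open>degree F \<le> degree F * h\<close> assms(5) unfolding prime_elem_def by linarith+
  define A where "A = {a. pshift a P dvd F}"
  have "card A \<le> degree F" unfolding A_def by (intro card_pshift_factors_le P F surj degP)
  hence "card A * h \<le> degree F * h" by simp
  hence cardA: "card A * h < CARD('a)" using assms(5) by linarith
  have "0 \<in> A" using P(2) by (simp add: A_def)
  hence "A \<noteq> {}" by blast
  then obtain t i where ti: "i \<in> S" "t - of_nat i \<in> A" "\<And>j. j \<in> S \<Longrightarrow> t - of_nat j \<in> A \<Longrightarrow> j = i"
    using exists_unique_representation[OF _ assms(3,4) cardA surj] by metis
  have fin: "finite S" using assms(4) finite_subset by blast
  have nz: "pshift a F \<noteq> 0" for a using F(1) by simp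
  have prm: "prime_elem (pshift t P)" using P(1) by (rule prime_elem_pshift)
  have mult: "multiplicity (pshift t P) (pshift (of_nat j) F) = (if j = i then 1 else 0)" if "j \<in> S" for j
  proof (cases "j = i")
    case True
    have "\<not> pshift t (P * P) dvd pshift (of_nat i) F"
    proof
      assume "pshift t (P * P) dvd pshift (of_nat i) F"
      hence "pshift (t - of_nat i) (P * P) dvd F" by (simp only: pshift_dvd_iff)
      hence "pshift (t - of_nat i) P * pshift (t - of_nat i) P dvd F" by (simp only: pshift_mult)
      moreover have "degree (pshift (t - of_nat i) P) > 0" using degP by simp
      ultimately show False using sf unfolding square_free_def by blast
    qed
    moreover have "pshift t P dvd pshift (of_nat i) F" using ti(2) by (simp add: pshift_dvd_iff A_def)
    ultimately show ?thesis using True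
      by (intro multiplicity_eqI) (auto simp: pshift_mult)
  next
    case False
    hence "\<not> pshift t P dvd pshift (of_nat j) F"
      using ti(3)[OF that] by (auto simp: pshift_dvd_iff A_def)
    thus ?thesis using False by (simp add: not_dvd_imp_multiplicity_0)
  qed
  have "multiplicity (pshift t P) (\<Prod>j\<in>S. pshift (of_nat j) F)
      = (\<Sum>j\<in>S. multiplicity (pshift t P) (pshift (of_nat j) F))"
    using nz fin by (intro prime_elem_multiplicity_prod_distrib[OF prm]) auto
  also have "\<dots> = (\<Sum>j\<in>S. if j = i then 1 else 0)" using mult by (intro sum.cong) auto
  also have "\<dots> = 1" using fin ti(1) by simp
  finally have "odd (multiplicity (pshift t P) (\<Prod>j\<in>S. pshift (of_nat j) F))" by simp
  thus ?thesis using prm nz fin by (intro nonsquare_polyI) auto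
qed

subsection \<open>Weil's bound for Legendre symbols\<close>

text \<open>Euler's criterion, made exact because -1, 0 and 1 are distinct modulo
  \<open>p > 2\<close>.\<close>

lemma Legendre_eq_iff_mod_ring:
  fixes a :: int
  assumes p: "CARD('a::prime_card) = 2 * q + 1" "0 < q" and e: "e = 1 \<or> e = -1"
  shows "Legendre a (int CARD('a)) = e \<longleftrightarrow> (of_int a :: 'a mod_ring) ^ q = of_int e"
proof -
  have p2: "CARD('a) > 2" using p by linarith
  have q: "(CARD('a) - 1) div 2 = q" unfolding p(1) by simp
  have "[Legendre a (int CARD('a)) = a ^ q] (mod int CARD('a))"
    using euler_criterion[OF prime_card p2] unfolding q .
  hence "(of_int (Legendre a (int CARD('a))) :: 'a mod_ring) = of_int a ^ q"
    unfolding of_int_power[symmetric] of_int_eq_iff_cong_CHAR semiring_char_mod_ring .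
  moreover have "of_int x = (of_int y :: 'a mod_ring) \<longleftrightarrow> x = y" if "x \<in> {-1, 0, 1}" "y \<in> {-1, 0, 1}" for x y
  proof
    assume "of_int x = (of_int y :: 'a mod_ring)"
    hence "int CARD('a) dvd x - y"
      unfolding of_int_eq_iff_cong_CHAR semiring_char_mod_ring by (simp add: cong_iff_dvd_diff)
    moreover have "\<bar>x - y\<bar> < int CARD('a)" using that p2 by auto
    ultimately show "x = y" using zdvd_not_zless[of "\<bar>x - y\<bar>" "int CARD('a)"] by auto
  qed simp
  moreover have "Legendre a (int CARD('a)) \<in> {-1, 0, 1}" by (simp add: Legendre_def)
  moreover have "e \<in> {-1, 0, 1}" using e by auto
  ultimately show ?thesis by metis
qed

lemma bij_betw_of_nat_mod_ring:
  "bij_betw (of_nat :: nat \<Rightarrow> 'a mod_ring) {..<CARD('a::prime_card)} UNIV"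
proof -
  have "(of_nat :: nat \<Rightarrow> 'a mod_ring) ` {..<CARD('a)} = UNIV"
    using surj_of_nat_mod_ring by blast
  moreover from this have "inj_on (of_nat :: nat \<Rightarrow> 'a mod_ring) {..<CARD('a)}"
    by (intro eq_card_imp_inj_on) (simp_all only: finite_lessThan card_lessThan CARD_mod_ring)
  ultimately show ?thesis unfolding bij_betw_def by blast
qed

lemma poly_map_of_int_mod_ring:
  "poly (map_poly of_int g) (of_nat n :: 'a::prime_card mod_ring) = of_int (poly g (int n))"
proof -
  have "poly (map_poly of_int g) (of_int (int n) :: 'a mod_ring) = of_int (poly g (int n))"
    by (rule of_int_hom.poly_map_poly)
  thus ?thesis unfolding of_int_of_nat_eq .
qed

lemma card_Legendre_zero_le:
  fixes g :: "int poly"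
  defines "f \<equiv> (map_poly of_int g :: 'a::prime_card mod_ring poly)"
  assumes "0 < degree f"
  shows "card {n\<in>{..<CARD('a)}. Legendre (poly g (int n)) (int CARD('a)) = 0} \<le> degree f"
proof -
  let ?p = "CARD('a)"
  let ?L = "\<lambda>n. Legendre (poly g (int n)) (int ?p)"
  have "poly f (of_nat n) = 0" if "?L n = 0" for n
  proof -
    have "[poly g (int n) = 0] (mod int ?p)" using that by (simp add: Legendre_def split: if_splits)
    hence "(of_int (poly g (int n)) :: 'a mod_ring) = of_int 0"
      unfolding of_int_eq_iff_cong_CHAR semiring_char_mod_ring .
    thus ?thesis unfolding f_def poly_map_of_int_mod_ring of_int_0 .
  qed
  hence "of_nat ` {n\<in>{..<?p}. ?L n = 0} \<subseteq> {x. poly f x = 0}" by blast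
  moreover have "inj_on (of_nat :: nat \<Rightarrow> 'a mod_ring) {n\<in>{..<?p}. ?L n = 0}"
    using bij_betw_imp_inj_on[OF bij_betw_of_nat_mod_ring] by (rule inj_on_subset) blast
  ultimately have "card {n\<in>{..<?p}. ?L n = 0} \<le> card {x. poly f x = 0}"
    by (intro card_inj_on_le) simp_all
  also have "\<dots> \<le> degree f"
    using assms(2) by (intro card_poly_roots_bound) auto
  finally show ?thesis .
qed

text \<open>Stepanov's method gives upper bounds only, but for both signs. Since the counts of 1, -1
  and 0 add up to \<open>p\<close>, the sum is twice one count plus the number of zeros minus
  \<open>p\<close>, up to sign: \<open>8 + 1 = 9\<close>.\<close>

lemma sum_Legendre_poly_le:
  fixes g :: "int poly"
  defines "f \<equiv> (map_poly of_int g :: 'a::prime_card mod_ring poly)"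
  assumes p: "CARD('a) \<ge> 1024" and nsq: "nonsquare_poly f" and deg: "16 * degree f \<le> CARD('a)"
  shows "\<bar>\<Sum>n<CARD('a). real_of_int (Legendre (poly g (int n)) (int CARD('a)))\<bar> \<le> 9 * degree f * sqrt CARD('a)"
proof -
  let ?p = "CARD('a)"
  let ?L = "\<lambda>n. Legendre (poly g (int n)) (int ?p)"
  have "odd ?p" using prime_odd_nat[OF prime_card[where ?'a='a]] p by linarith
  then obtain q where q: "?p = 2 * q + 1" by (elim oddE)
  have "0 < q" using p q by linarith
  note poly_f = poly_map_of_int_mod_ring[of g, where ?'a='a, folded f_def]
  have count: "real (card {n\<in>{..<?p}. ?L n = e}) \<le> ?p / 2 + 4 * degree f * sqrt ?p" if e: "e = 1 \<or> e = -1" for e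
  proof -
    have "?L n = e \<longleftrightarrow> poly f (of_nat n) ^ q = of_int e" for n
      unfolding poly_f by (rule Legendre_eq_iff_mod_ring[OF q \<open>0 < q\<close> e])
    hence "of_nat ` {n\<in>{..<?p}. ?L n = e} \<subseteq> {x. poly f x ^ q = of_int e}" by blast
    moreover have "inj_on (of_nat :: nat \<Rightarrow> 'a mod_ring) {n\<in>{..<?p}. ?L n = e}"
      using bij_betw_imp_inj_on[OF bij_betw_of_nat_mod_ring] by (rule inj_on_subset) blast
    ultimately have "card {n\<in>{..<?p}. ?L n = e} \<le> card {x. poly f x ^ q = of_int e}"
      by (intro card_inj_on_le) simp_all
    with card_power_eq_le[OF q p nsq deg, of "of_int e"] show ?thesis by linarith
  qed
  have zeros: "card {n\<in>{..<?p}. ?L n = 0} \<le> degree f"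
    using card_Legendre_zero_le[of g, where ?'a='a] degree_pos_if_nonsquare_poly[OF nsq] unfolding f_def by blast
  have cases: "?L n = 1 \<or> ?L n = -1 \<or> ?L n = 0" for n by (simp add: Legendre_def)
  let ?N = "\<lambda>e. real (card {n\<in>{..<?p}. ?L n = e})"
  have N: "?N e = (\<Sum>n<?p. if ?L n = e then 1 else 0)" for e
    by (simp add: sum.inter_filter[symmetric])
  have "(1 :: real) = (if ?L n = 1 then 1 else 0) + (if ?L n = -1 then 1 else 0) + (if ?L n = 0 then 1 else 0)" for n
    using cases[of n] by auto
  from sum.cong[OF refl this, of "{..<?p}"]
  have tot: "real ?p = ?N 1 + ?N (-1) + ?N 0" unfolding N sum.distrib by simp
  have "real_of_int (?L n) = (if ?L n = 1 then 1 else 0) - (if ?L n = -1 then 1 else 0)" for n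
    using cases[of n] by auto
  hence "(\<Sum>n<?p. real_of_int (?L n)) = ?N 1 - ?N (-1)" unfolding N by (simp add: sum_subtractf)
  moreover have "1 \<le> sqrt ?p" using p by (intro real_le_rsqrt) simp
  from mult_left_mono[OF this, of "degree f"] have "real (degree f) \<le> real (degree f) * sqrt ?p" by simp
  moreover have "real (4 * degree f) * sqrt ?p = 4 * (real (degree f) * sqrt ?p)"
    "real (9 * degree f) * sqrt ?p = 9 * (real (degree f) * sqrt ?p)" by simp_all
  moreover have "?N 0 \<le> degree f" using zeros by simp
  ultimately show ?thesis using tot count[of 1] count[of "-1"] unfolding abs_le_iff by linarith
qed

text \<open>A statement about the number \<open>p\<close> alone, free of type variables, so that it
  can be transferred from types of prime cardinality to all primes.\<close>

definition shifted_Legendre_bound :: "nat \<Rightarrow> bool" where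
  "shifted_Legendre_bound p \<longleftrightarrow>
    (\<forall>F. 0 < poly_mod.degree_m (int p) F \<longrightarrow>
      card {n\<in>{..<p}. Legendre (poly F (int n)) (int p) = 0} \<le> poly_mod.degree_m (int p) F) \<and>
    (\<forall>F S h. poly_mod.square_free_m (int p) F \<longrightarrow>
     0 < poly_mod.degree_m (int p) F \<longrightarrow> S \<noteq> {} \<longrightarrow> S \<subseteq> {..<h} \<longrightarrow>
     16 * (poly_mod.degree_m (int p) F * h) \<le> p \<longrightarrow>
     \<bar>\<Sum>n<p. real_of_int (Legendre (\<Prod>i\<in>S. poly F (int (n + i))) (int p))\<bar>
       \<le> 9 * (poly_mod.degree_m (int p) F * h) * sqrt p)"

lemma shifted_Legendre_bound_CARD:
  assumes "CARD('a::prime_card) \<ge> 1024"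
  shows "shifted_Legendre_bound CARD('a)"
  unfolding shifted_Legendre_bound_def
proof (intro conjI allI impI)
  let ?p = "CARD('a)"
  interpret poly_mod_prime_type "int ?p" "TYPE('a)" by unfold_locales (simp_all add: prime_card_int)
  \<comment> \<open>Reducing coefficients by \<open>of_int\<close> gives the field polynomial
    represented by \<open>F\<close>; the relation carries degree and square-freeness over.\<close>
  have rel: "MP_Rel F (map_poly of_int F)" for F unfolding MP_Rel_def by (rule Mp_f_representative)
  note deg = rel_funD[OF degree_MP_Rel rel]
  show "card {n\<in>{..<?p}. Legendre (poly F (int n)) (int ?p) = 0} \<le> degree_m F" if "0 < degree_m F" for F
    using card_Legendre_zero_le[of F, where ?'a='a] that unfolding deg by blast
  fix F :: "int poly" and S h
  assume F: "poly_mod.square_free_m (int ?p) F" "0 < poly_mod.degree_m (int ?p) F"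
    and S: "S \<noteq> {}" "S \<subseteq> {..<h}" and h: "16 * (poly_mod.degree_m (int ?p) F * h) \<le> ?p"
  define f where "f = (map_poly of_int F :: 'a mod_ring poly)"
  note deg = deg[of F, folded f_def]
  have sf: "square_free f" using rel_funD[OF square_free_MP_Rel rel] F(1) unfolding f_def by blast
  have "?p > 0" using assms by linarith
  hence "degree f * h < ?p" using h unfolding deg by linarith
  hence card: "degree f * h < CARD('a mod_ring)" unfolding CARD_mod_ring .
  have nsq: "nonsquare_poly (\<Prod>i\<in>S. pshift (of_nat i) f)"
  proof (rule nonsquare_poly_prod_pshift[OF sf _ S card])
    show "0 < degree f" using F(2) unfolding deg .
    show "\<exists>k. x = of_nat k" for x :: "'a mod_ring" using surj_of_nat_mod_ring[of x] by blast
  qed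
  \<comment> \<open>An integer lift of the product of translates, to which the bound for a single
    polynomial applies.\<close>
  define g where "g = (\<Prod>i\<in>S. pshift (int i) F)"
  have "map_poly of_int (pshift (int i) F) = pshift (of_nat i) f" for i
    unfolding pshift_def f_def of_int_hom.map_poly_pcompose
    by (simp only: of_int_hom.map_poly_pCons_hom of_int_of_nat_eq of_int_1 map_poly_0)
  hence g: "map_poly of_int g = (\<Prod>i\<in>S. pshift (of_nat i) f)"
    unfolding g_def of_int_poly_hom.hom_prod by (intro prod.cong refl)
  have "finite S" using S finite_subset by blast
  have "degree (\<Prod>i\<in>S. pshift (of_nat i) f) \<le> (\<Sum>i\<in>S. degree (pshift (of_nat i) f))"
    using degree_prod_sum_le[of S "\<lambda>i. pshift (of_nat i) f"] \<open>finite S\<close> by (simp add: o_def)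
  also have "\<dots> = card S * degree f" by simp
  also have "\<dots> \<le> h * degree f" using card_mono[OF _ S(2)] by (intro mult_right_mono) auto
  finally have degg: "degree (map_poly of_int g :: 'a mod_ring poly) \<le> degree f * h"
    unfolding g by (simp only: mult.commute)
  have "\<bar>\<Sum>n<?p. real_of_int (Legendre (poly g (int n)) (int ?p))\<bar>
      \<le> 9 * degree (map_poly of_int g :: 'a mod_ring poly) * sqrt ?p"
    by (rule sum_Legendre_poly_le) (use assms nsq degg h in \<open>simp_all add: g deg\<close>)
  also have "\<dots> \<le> 9 * (degree f * h) * sqrt ?p"
    using degg by (intro mult_right_mono) (simp_all flip: of_nat_mult)
  finally show "\<bar>\<Sum>n<?p. real_of_int (Legendre (\<Prod>i\<in>S. poly F (int (n + i))) (int ?p))\<bar>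
       \<le> 9 * (poly_mod.degree_m (int ?p) F * h) * sqrt ?p"
    unfolding g_def deg poly_prod poly_pshift of_nat_add by (simp only: add.commute)
qed

text \<open>
  The bound has been proved for primes that are the cardinality of a type. Since a type cannot depend
  on a variable, the passage to all primes applies it to a type whose cardinality is a fixed
  counterexample, if there is one; the value 2 in the other case is arbitrary.
\<close>

definition bad_prime :: nat where
  "bad_prime = (if \<exists>p. prime p \<and> p \<ge> 1024 \<and> \<not> shifted_Legendre_bound p
     then SOME p. prime p \<and> p \<ge> 1024 \<and> \<not> shifted_Legendre_bound p else 2)"

lemma bad_primeI:
  assumes "prime p" "p \<ge> 1024" "\<not> shifted_Legendre_bound p"
  shows "prime bad_prime" "bad_prime \<ge> 1024" "\<not> shifted_Legendre_bound bad_prime"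
proof -
  have "\<exists>p. prime p \<and> p \<ge> 1024 \<and> \<not> shifted_Legendre_bound p" using assms by blast
  from someI_ex[OF this] this
  show "prime bad_prime" "bad_prime \<ge> 1024" "\<not> shifted_Legendre_bound bad_prime"
    unfolding bad_prime_def by simp_all
qed

lemma prime_bad_prime: "prime bad_prime"
proof (cases "\<exists>p. prime p \<and> p \<ge> 1024 \<and> \<not> shifted_Legendre_bound p")
  case True
  thus ?thesis using bad_primeI(1) by blast
next
  case False
  hence "bad_prime = 2" unfolding bad_prime_def by (rule if_not_P)
  thus ?thesis using two_is_prime_nat by (simp only:)
qed

typedef bad_residue = "{..<bad_prime}"
  using prime_gt_0_nat[OF prime_bad_prime] by blast

lemma CARD_bad_residue: "CARD(bad_residue) = bad_prime"
  using type_definition.card[OF type_definition_bad_residue] by simp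

instance bad_residue :: prime_card
  by standard (simp only: CARD_bad_residue prime_bad_prime)

theorem shifted_Legendre_bound:
  assumes "prime p" "p \<ge> 1024"
  shows "shifted_Legendre_bound p"
  using bad_primeI[OF assms] shifted_Legendre_bound_CARD[where ?'a = bad_residue]
  unfolding CARD_bad_residue by blast

subsection \<open>Sign patterns\<close>

lemma real_card_le_power_2:
  assumes "B \<subseteq> Pow {..<l :: nat}"
  shows "real (card B) \<le> 2 ^ l"
proof -
  have "card B \<le> card (Pow {..<l})" using assms by (intro card_mono) auto
  hence "real (card B) \<le> real (2 ^ l)" by (intro of_nat_mono) (simp add: card_Pow)
  thus ?thesis by simp
qed

text \<open>Away from zeros of \<open>s\<close>, the nonnegative product \<open>T n\<close> is
  \<open>2 ^ l\<close> times the indicator of the pattern. Expanding it over subsets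
  \<open>S\<close>, the empty set contributes \<open>p\<close> and each other set at most
  \<open>W\<close>. At most \<open>l * D\<close> values of \<open>n\<close> meet a zero.\<close>

lemma card_sign_pattern_le:
  fixes s :: "nat \<Rightarrow> int"
  assumes s: "\<And>n. s n \<in> {-1, 0, 1}" and e: "e = 1 \<or> e = -1"
    and W: "\<And>S. S \<noteq> {} \<Longrightarrow> S \<subseteq> {..<l} \<Longrightarrow> \<bar>\<Sum>n<p. real_of_int (\<Prod>i\<in>S. s (n + i))\<bar> \<le> W"
    and Z: "\<And>i. i < l \<Longrightarrow> card {n\<in>{..<p}. s (n + i) = 0} \<le> D"
    and A: "A \<subseteq> {..<l}" and "0 \<le> W"
  shows "real (card {n\<in>{..<p}. {t\<in>{..<l}. s (n + t) = e} = A}) \<le> p / 2 ^ l + W + l * D"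
proof -
  define N where "N = {n\<in>{..<p}. {t\<in>{..<l}. s (n + t) = e} = A}"
  define Z0 where "Z0 = (\<Union>i<l. {n\<in>{..<p}. s (n + i) = 0})"
  \<comment> \<open>The prescribed sign at position \<open>t\<close>: each factor of
    \<open>T\<close> is 2 on agreement, 0 on disagreement and 1 at a zero of
    \<open>s\<close>.\<close>
  define u :: "nat \<Rightarrow> real" where "u = (\<lambda>t. if t \<in> A then of_int e else - of_int e)"
  define T where "T = (\<lambda>n. \<Prod>t<l. 1 + u t * of_int (s (n + t)))"
  have u1: "\<bar>u t\<bar> = 1" for t using e by (auto simp: u_def)
  have "card Z0 \<le> (\<Sum>i<l. card {n\<in>{..<p}. s (n + i) = 0})"
    unfolding Z0_def by (rule card_UN_le) simp
  also have "\<dots> \<le> (\<Sum>i<l. D)" by (intro sum_mono Z) simp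
  finally have cZ0: "card Z0 \<le> l * D" by simp
  have T_nonneg: "T n \<ge> 0" for n
    unfolding T_def
  proof (intro prod_nonneg ballI)
    fix t
    show "0 \<le> 1 + u t * of_int (s (n + t))" using s[of "n + t"] e by (auto simp: u_def)
  qed
  have T_eq: "T n = 2 ^ l" if "n \<in> N - Z0" for n
  proof -
    have n: "n < p" "{t\<in>{..<l}. s (n + t) = e} = A" using that by (auto simp: N_def)
    have "1 + u t * of_int (s (n + t)) = 2" if "t < l" for t
    proof (cases "t \<in> A")
      case True
      thus ?thesis using n(2) e by (auto simp: u_def)
    next
      case False
      have "s (n + t) \<noteq> 0" using \<open>n \<in> N - Z0\<close> n(1) that by (auto simp: Z0_def)
      moreover have "s (n + t) \<noteq> e" using False n(2) that by blast
      ultimately have "s (n + t) = - e" using s[of "n + t"] e by auto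
      thus ?thesis using False e by (auto simp: u_def)
    qed
    thus ?thesis unfolding T_def by (simp add: prod.cong[of _ _ _ "\<lambda>_. 2"])
  qed
  have expand: "(\<Sum>n<p. T n) = (\<Sum>S\<in>Pow {..<l}. (\<Prod>t\<in>S. u t) * (\<Sum>n<p. real_of_int (\<Prod>t\<in>S. s (n + t))))"
  proof -
    have "T n = (\<Sum>S\<in>Pow {..<l}. (\<Prod>t\<in>S. u t) * real_of_int (\<Prod>t\<in>S. s (n + t)))" for n
      unfolding T_def using prod_add[of "{..<l}" "\<lambda>t. u t * of_int (s (n + t))" "\<lambda>_. 1"]
      by (simp add: add.commute prod.distrib)
    thus ?thesis by (simp add: sum_distrib_left sum.swap[of _ _ "{..<p}"])
  qed
  have "2 ^ l * real (card (N - Z0)) = (\<Sum>n\<in>N - Z0. T n)" using T_eq by simp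
  also have "\<dots> \<le> (\<Sum>n<p. T n)"
    by (intro sum_mono2) (auto simp: N_def T_nonneg)
  also have "\<dots> \<le> (\<Sum>S\<in>Pow {..<l}. if S = {} then real p else W)"
    unfolding expand
  proof (intro sum_mono)
    fix S assume S: "S \<in> Pow {..<l}"
    show "(\<Prod>t\<in>S. u t) * (\<Sum>n<p. real_of_int (\<Prod>t\<in>S. s (n + t))) \<le> (if S = {} then real p else W)"
    proof (cases "S = {}")
      case False
      have "\<bar>\<Prod>t\<in>S. u t\<bar> = 1" by (simp add: abs_prod u1)
      hence "\<bar>(\<Prod>t\<in>S. u t) * (\<Sum>n<p. real_of_int (\<Prod>t\<in>S. s (n + t)))\<bar> \<le> W"
        using W[of S] S False by (simp add: abs_mult)
      thus ?thesis using False by simp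
    qed simp
  qed
  also have "\<dots> = real p + (\<Sum>S\<in>Pow {..<l} - {{}}. W)"
    by (subst sum.remove[of _ "{}"]) auto
  also have "\<dots> \<le> real p + 2 ^ l * W"
  proof (rule add_left_mono)
    have "real (card (Pow {..<l} - {{}})) * W \<le> 2 ^ l * W"
      by (rule mult_right_mono[OF real_card_le_power_2[OF Diff_subset] \<open>0 \<le> W\<close>])
    thus "(\<Sum>S\<in>Pow {..<l} - {{}}. W) \<le> 2 ^ l * W" by (simp only: sum_constant)
  qed
  finally have "2 ^ l * real (card (N - Z0)) \<le> 2 ^ l * (p / 2 ^ l + W)" by (simp add: distrib_left)
  hence "real (card (N - Z0)) \<le> p / 2 ^ l + W" by (rule mult_left_le_imp_le) simp
  moreover have "card N \<le> card (N - Z0) + card Z0"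
    by (rule order_trans[OF card_mono card_Un_le]) (auto simp: N_def Z0_def)
  moreover have "real (card Z0) \<le> real l * real D" using cZ0 by (simp flip: of_nat_mult)
  ultimately show ?thesis unfolding N_def by linarith
qed

text \<open>The expectation of \<open>f\<close> at a binomial variable with \<open>l\<close> trials
  and probability 1/2.\<close>

definition subset_mean :: "nat \<Rightarrow> (nat \<Rightarrow> real) \<Rightarrow> real" where
  "subset_mean l f = (\<Sum>A\<in>Pow {..<l}. f (card A)) / 2 ^ l"

text \<open>Subsets are split according to whether they contain \<open>l\<close>; one more trial
  averages \<open>f\<close> with its shift.\<close>

lemma subset_mean_Suc: "subset_mean (Suc l) f = subset_mean l (\<lambda>k. (f k + f (Suc k)) / 2)"
proof -
  have "(\<Sum>A\<in>Pow {..<Suc l}. f (card A))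
      = (\<Sum>A\<in>Pow {..<l}. f (card A)) + (\<Sum>A\<in>insert l ` Pow {..<l}. f (card A))"
    unfolding lessThan_Suc Pow_insert by (intro sum.union_disjoint) auto
  also have "(\<Sum>A\<in>insert l ` Pow {..<l}. f (card A)) = (\<Sum>A\<in>Pow {..<l}. f (Suc (card A)))"
  proof (subst sum.reindex)
    show "inj_on (insert l) (Pow {..<l})" by (auto simp: inj_on_def)
    show "sum ((\<lambda>A. f (card A)) \<circ> insert l) (Pow {..<l}) = (\<Sum>A\<in>Pow {..<l}. f (Suc (card A)))"
    proof (intro sum.cong refl)
      fix A assume "A \<in> Pow {..<l}"
      hence "finite A" "l \<notin> A" using finite_subset by auto
      thus "((\<lambda>A. f (card A)) \<circ> insert l) A = f (Suc (card A))" by simp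
    qed
  qed
  finally show ?thesis unfolding subset_mean_def
    by (simp add: sum.distrib sum_divide_distrib[symmetric])
qed

text \<open>
  The function \<open>G\<close> in the proof solves \<open>(G k - G (k + 1)) / 2 = of_bool (m dvd k) - 1 / m\<close>, which makes
  the sum telescope.
\<close>

lemma sum_subset_mean_dvd_le:
  assumes m: "m \<ge> 2"
  shows "(\<Sum>l<L. subset_mean l (\<lambda>k. of_bool (m dvd k)) - 1 / m) \<le> 2"
proof -
  define G :: "nat \<Rightarrow> real" where "G = (\<lambda>k. if m dvd k then 2 else 2 * (k mod m) / m)"
  have G_Suc: "(G k + G (Suc k)) / 2 = G k - (of_bool (m dvd k) - 1 / m)" for k
  proof -
    consider "m dvd k" | "\<not> m dvd k" "Suc (k mod m) = m" | "\<not> m dvd k" "Suc (k mod m) \<noteq> m" by blast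
    thus ?thesis
    proof cases
      case 1
      hence "Suc k mod m = 1" using m by (simp add: mod_Suc)
      moreover from this have "\<not> m dvd Suc k" by (simp add: dvd_eq_mod_eq_0)
      ultimately have "G k = 2" "G (Suc k) = 2 / m" using 1 by (simp_all add: G_def)
      thus ?thesis using 1 by simp
    next
      case 2
      hence "Suc k mod m = 0" by (simp add: mod_Suc)
      hence "m dvd Suc k" unfolding dvd_eq_mod_eq_0 .
      hence "G k = 2 * (k mod m) / m" "G (Suc k) = 2" using 2 by (simp_all add: G_def)
      moreover have "real (k mod m) = real m - 1" using 2(2) by linarith
      moreover have "2 * (real m - 1) / m = 2 - 2 / m" using m by (simp add: field_simps)
      ultimately show ?thesis using 2(1) by simp
    next
      case 3
      hence "Suc k mod m = Suc (k mod m)" by (simp add: mod_Suc)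
      moreover from this have "\<not> m dvd Suc k" unfolding dvd_eq_mod_eq_0 by linarith
      ultimately have "G k = 2 * (k mod m) / m" "G (Suc k) = 2 * Suc (k mod m) / m"
        using 3 by (simp_all add: G_def)
      moreover have "2 * real (Suc (k mod m)) / m = 2 * (k mod m) / m + 2 / m"
        by (simp add: add_divide_distrib)
      ultimately show ?thesis using 3(1) by simp
    qed
  qed
  have step: "subset_mean l (\<lambda>k. of_bool (m dvd k)) - 1 / m = subset_mean l G - subset_mean (Suc l) G" for l
  proof -
    have "subset_mean (Suc l) G
        = subset_mean l G - (subset_mean l (\<lambda>k. of_bool (m dvd k)) - (\<Sum>A\<in>Pow {..<l}. 1 / m) / 2 ^ l)"
      unfolding subset_mean_Suc G_Suc unfolding subset_mean_def sum_subtractf by (simp only: diff_divide_distrib)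
    thus ?thesis by (simp add: card_Pow)
  qed
  \<comment> \<open>The bound 2 is the initial value \<open>G 0\<close>; what is subtracted is
    nonnegative.\<close>
  have "(\<Sum>l<L. subset_mean l (\<lambda>k. of_bool (m dvd k)) - 1 / m) = subset_mean 0 G - subset_mean L G"
    unfolding step by (rule sum_lessThan_telescope')
  moreover have "subset_mean 0 G = 2" by (simp add: subset_mean_def G_def)
  moreover have "subset_mean L G \<ge> 0" unfolding subset_mean_def
    by (intro divide_nonneg_nonneg sum_nonneg) (auto simp: G_def)
  ultimately show ?thesis by linarith
qed

text \<open>A union bound over the patterns of cardinality divisible by \<open>m\<close>: their main
  terms add up to the mean, and the error is incurred at most \<open>2 ^ l\<close> times.\<close>

lemma card_dvd_pattern_le:
  fixes s :: "nat \<Rightarrow> int"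
  assumes s: "\<And>n. s n \<in> {-1, 0, 1}" and e: "e = 1 \<or> e = -1"
    and W: "\<And>S. S \<noteq> {} \<Longrightarrow> S \<subseteq> {..<l} \<Longrightarrow> \<bar>\<Sum>n<p. real_of_int (\<Prod>i\<in>S. s (n + i))\<bar> \<le> W"
    and Z: "\<And>i. i < l \<Longrightarrow> card {n\<in>{..<p}. s (n + i) = 0} \<le> D"
    and "0 \<le> W"
  shows "real (card {n\<in>{..<p}. m dvd card {t\<in>{..<l}. s (n + t) = e}})
    \<le> p * subset_mean l (\<lambda>k. of_bool (m dvd k)) + 2 ^ l * (W + l * D)"
proof -
  let ?P = "\<lambda>n. {t\<in>{..<l}. s (n + t) = e}"
  let ?B = "{A \<in> Pow {..<l}. m dvd card A}"
  have "{n\<in>{..<p}. m dvd card (?P n)} \<subseteq> (\<Union>A\<in>?B. {n\<in>{..<p}. ?P n = A})" by auto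
  hence "card {n\<in>{..<p}. m dvd card (?P n)} \<le> card (\<Union>A\<in>?B. {n\<in>{..<p}. ?P n = A})"
    by (intro card_mono) auto
  also have "\<dots> \<le> (\<Sum>A\<in>?B. card {n\<in>{..<p}. ?P n = A})" by (rule card_UN_le) simp
  finally have "real (card {n\<in>{..<p}. m dvd card (?P n)}) \<le> (\<Sum>A\<in>?B. real (card {n\<in>{..<p}. ?P n = A}))"
    by (simp flip: of_nat_sum)
  also have "\<dots> \<le> (\<Sum>A\<in>?B. p / 2 ^ l + W + l * D)"
  proof (rule sum_mono)
    fix A assume "A \<in> ?B"
    hence A: "A \<subseteq> {..<l}" by blast
    show "real (card {n\<in>{..<p}. ?P n = A}) \<le> p / 2 ^ l + W + real (l * D)"
      unfolding of_nat_mult by (rule card_sign_pattern_le[OF s e W Z A \<open>0 \<le> W\<close>])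
  qed
  also have "\<dots> = p * (card ?B / 2 ^ l) + card ?B * (W + l * D)" by (simp add: algebra_simps)
  also have "real (card ?B) = (\<Sum>A\<in>Pow {..<l}. of_bool (m dvd card A))"
    by (simp add: of_bool_def sum.inter_filter[symmetric])
  hence "card ?B / 2 ^ l = subset_mean l (\<lambda>k. of_bool (m dvd k))" unfolding subset_mean_def by simp
  also have "card ?B * (W + l * D) \<le> 2 ^ l * (W + l * D)"
    by (intro mult_right_mono real_card_le_power_2) (use \<open>0 \<le> W\<close> in auto)
  finally show ?thesis by simp
qed

subsection \<open>Equidistribution modulo \<open>m\<close>\<close>

lemma sum_shift_le:
  fixes f :: "nat \<Rightarrow> real"
  assumes "\<And>n. 0 \<le> f n" "\<And>n. f n \<le> 1"
  shows "\<bar>(\<Sum>n<p. f (n + i)) - (\<Sum>n<p. f n)\<bar> \<le> i"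
proof (induction i)
  case (Suc i)
  have "(\<Sum>n<p. f (Suc n + i)) + f i = (\<Sum>n<Suc p. f (n + i))"
    by (subst sum.lessThan_Suc_shift) simp
  hence "(\<Sum>n<p. f (n + Suc i)) - (\<Sum>n<p. f (n + i)) = f (p + i) - f i" by simp
  moreover have "\<bar>f (p + i) - f i\<bar> \<le> 1" using assms[of "p + i"] assms[of i] by linarith
  ultimately show ?case using Suc by (simp add: abs_le_iff)
qed simp

lemma sum_periodic_shift:
  fixes f :: "nat \<Rightarrow> 'a::ab_group_add"
  assumes "\<And>n. f (n + p) = f n"
  shows "(\<Sum>n<p. f (n + i)) = (\<Sum>n<p. f n)"
proof (induction i)
  case (Suc i)
  have "(\<Sum>n<p. f (Suc n + i)) + f i = (\<Sum>n<Suc p. f (n + i))"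
    by (subst sum.lessThan_Suc_shift) simp
  moreover have "f (p + i) = f i" using assms[of i] by (simp add: add.commute)
  ultimately show ?case using Suc by simp
qed simp

lemma card_periodic_shift:
  assumes "\<And>n. Q (n + p) \<longleftrightarrow> Q n"
  shows "card {n\<in>{..<p}. Q (n + i)} = card {n\<in>{..<p::nat}. Q n}"
proof -
  have c: "int (card {n\<in>{..<p}. R n}) = (\<Sum>n<p. of_bool (R n))" for R
    by (simp add: of_bool_def sum.inter_filter[symmetric])
  have "int (card {n\<in>{..<p}. Q (n + i)}) = int (card {n\<in>{..<p}. Q n})"
    unfolding c using sum_periodic_shift[of "\<lambda>n. of_bool (Q n) :: int" p i] assms by simp
  thus ?thesis by simp
qed

text \<open>Nonnegativity of the variance of \<open>v\<close>.\<close>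

lemma sum_square_mean_le:
  fixes v :: "nat \<Rightarrow> real"
  assumes "p > 0"
  shows "((\<Sum>n<p. v n) / p)\<^sup>2 \<le> (\<Sum>n<p. (v n)\<^sup>2) / p"
proof -
  define y where "y = (\<Sum>n<p. v n) / p"
  have y: "(\<Sum>n<p. v n) = p * y" using assms by (simp add: y_def)
  have "0 \<le> (\<Sum>n<p. (v n - y)\<^sup>2)" by (intro sum_nonneg) simp
  also have "\<dots> = (\<Sum>n<p. (v n)\<^sup>2 - 2 * y * v n + y\<^sup>2)"
    by (intro sum.cong refl) (simp add: power2_diff algebra_simps)
  also have "\<dots> = (\<Sum>n<p. (v n)\<^sup>2) - p * y\<^sup>2"
    by (simp add: sum.distrib sum_subtractf sum_distrib_left[symmetric] y power2_eq_square)
  finally show ?thesis using assms unfolding y_def[symmetric] by (simp add: field_simps)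
qed

text \<open>Only initial sums of \<open>g\<close> are controlled, since single values may be
  negative. The indices from \<open>i\<close> on give one initial sum, those below \<open>i\<close>
  another one with \<open>g 0\<close> removed.\<close>

lemma sum_dist_le:
  fixes g :: "nat \<Rightarrow> real"
  assumes "\<And>L. (\<Sum>l<L. g l) \<le> B" "0 \<le> g 0" "i < h"
  shows "(\<Sum>j<h. g (if i \<le> j then j - i else i - j)) \<le> 2 * B"
proof -
  let ?f = "\<lambda>j. g (if i \<le> j then j - i else i - j)"
  have split: "{..<h} = {..<i} \<union> {i..<h}" using assms(3) by auto
  have "(\<Sum>j<h. ?f j) = (\<Sum>j<i. ?f j) + (\<Sum>j=i..<h. ?f j)"
    unfolding split by (intro sum.union_disjoint) auto
  also have "(\<Sum>j<i. ?f j) = (\<Sum>l<i. g (Suc l))"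
    by (rule sum.reindex_bij_witness[of _ "\<lambda>l. i - Suc l" "\<lambda>j. i - Suc j"]) (auto simp: Suc_diff_Suc)
  also have "(\<Sum>l<i. g (Suc l)) = (\<Sum>l<Suc i. g l) - g 0" unfolding sum.lessThan_Suc_shift by simp
  also have "(\<Sum>j=i..<h. ?f j) = (\<Sum>l<h - i. g l)"
    by (rule sum.reindex_bij_witness[of _ "\<lambda>l. l + i" "\<lambda>j. j - i"]) auto
  finally show ?thesis using assms(1)[of "Suc i"] assms(1)[of "h - i"] assms(2) by linarith
qed

text \<open>The increment of \<open>b\<close> over \<open>l\<close> steps counts the values
  \<open>e\<close> in a window of \<open>s\<close>, so a return modulo \<open>m\<close> means that
  \<open>m\<close> divides this count. Periodicity of \<open>s\<close> removes the offset
  \<open>i + r\<close>.\<close>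

lemma card_walk_return_le:
  fixes s :: "nat \<Rightarrow> int" and b :: "nat \<Rightarrow> nat"
  assumes s: "\<And>n. s n \<in> {-1, 0, 1}" and per: "\<And>n. s (n + p) = s n" and e: "e = 1 \<or> e = -1"
    and W: "\<And>S. S \<noteq> {} \<Longrightarrow> S \<subseteq> {..<h} \<Longrightarrow> \<bar>\<Sum>n<p. real_of_int (\<Prod>i\<in>S. s (n + i))\<bar> \<le> W"
    and Z: "card {n\<in>{..<p}. s n = 0} \<le> D" and W0: "0 \<le> W"
    and b: "\<And>k. b (Suc k) = b k + of_bool (s (k + r) = e)" and l: "l \<le> h"
  shows "real (card {n\<in>{..<p}. b (n + i + l) mod m = b (n + i) mod m})
    \<le> p * subset_mean l (\<lambda>k. of_bool (m dvd k)) + 2 ^ h * (W + real h * real D)"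
proof -
  have b_add: "b (k + l) = b k + card {t\<in>{..<l}. s (k + t + r) = e}" for k l
  proof (induction l)
    case (Suc l)
    have "{t\<in>{..<Suc l}. s (k + t + r) = e}
        = (if s (k + l + r) = e then insert l {t\<in>{..<l}. s (k + t + r) = e} else {t\<in>{..<l}. s (k + t + r) = e})"
      by (auto simp: less_Suc_eq)
    thus ?case using Suc b[of "k + l"] by simp
  qed simp
  have dvd: "(x + y) mod m = x mod m \<longleftrightarrow> m dvd y" for x y :: nat
    by (metis cong_def cong_add_lcancel_0_nat cong_0_iff)
  let ?Q = "\<lambda>n. m dvd card {t\<in>{..<l}. s (n + t) = e}"
  have per': "s (n + p + t) = s (n + t)" for n t using per[of "n + t"] by (simp add: ac_simps)
  have "{n\<in>{..<p}. b (n + i + l) mod m = b (n + i) mod m} = {n\<in>{..<p}. ?Q (n + (i + r))}"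
    unfolding b_add dvd by (simp add: ac_simps)
  also have "card \<dots> = card {n\<in>{..<p}. ?Q n}"
    by (rule card_periodic_shift) (simp only: per')
  also have "real \<dots> \<le> p * subset_mean l (\<lambda>k. of_bool (m dvd k)) + 2 ^ l * (W + real l * real D)"
  proof (rule card_dvd_pattern_le[OF s e _ _ W0])
    show "\<bar>\<Sum>n<p. real_of_int (\<Prod>i\<in>S. s (n + i))\<bar> \<le> W" if "S \<noteq> {}" "S \<subseteq> {..<l}" for S
      by (rule W) (use that l in auto)
    show "card {n\<in>{..<p}. s (n + i) = 0} \<le> D" for i
      using card_periodic_shift[of "\<lambda>n. s n = 0" p i] per Z by simp
  qed
  also have "2 ^ l * (W + real l * real D) \<le> 2 ^ h * (W + real h * real D)"
    using l W0 by (intro mult_mono power_increasing add_left_mono of_nat_mono mult_right_mono) auto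
  finally show ?thesis by simp
qed

text \<open>
  The three terms come from the bound 2 for the sums of excesses, from the error in the frequency of
  sign patterns, and from replacing \<open>b n\<close> by \<open>b (n + i)\<close>.
\<close>

lemma walk_equidistribution:
  fixes s :: "nat \<Rightarrow> int" and b :: "nat \<Rightarrow> nat"
  assumes s: "\<And>n. s n \<in> {-1, 0, 1}" and per: "\<And>n. s (n + p) = s n" and e: "e = 1 \<or> e = -1"
    and W: "\<And>S. S \<noteq> {} \<Longrightarrow> S \<subseteq> {..<h} \<Longrightarrow> \<bar>\<Sum>n<p. real_of_int (\<Prod>i\<in>S. s (n + i))\<bar> \<le> W"
    and Z: "card {n\<in>{..<p}. s n = 0} \<le> D" and W0: "0 \<le> W"
    and b: "\<And>k. b (Suc k) = b k + of_bool (s (k + r) = e)"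
    and m: "m \<ge> 2" and h: "h > 0" and p: "p > 0"
  shows "(\<Sum>a<m. (real (card {n\<in>{..<p}. b n mod m = a}) / p - 1 / m)\<^sup>2)
    \<le> 8 / h + 2 * (2 ^ h * (W + real h * real D)) / p + 2 * m * (h / p)\<^sup>2"
proof -
  define c :: "nat \<Rightarrow> nat \<Rightarrow> real" where "c = (\<lambda>a n. of_bool (b n mod m = a))"
  define E where "E = 2 ^ h * (W + real h * real D)"
  \<comment> \<open>Here \<open>x a\<close> is the discrepancy to be bounded, \<open>v a n\<close>
    its version on the window of length \<open>h\<close> at \<open>n\<close>, and \<open>y a\<close>
    the mean of \<open>v a n\<close> over \<open>n\<close>.\<close>
  define x where "x = (\<lambda>a. (\<Sum>n<p. c a n) / p - 1 / m)"
  define v where "v = (\<lambda>a n. (\<Sum>i<h. c a (n + i)) / h - 1 / m)"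
  define y where "y = (\<lambda>a. (\<Sum>n<p. v a n) / p)"
  define P where "P = (\<lambda>l. subset_mean l (\<lambda>k. of_bool (m dvd k)) - 1 / m)"
  have sum_c: "(\<Sum>n<p. of_bool (Q n)) = real (card {n\<in>{..<p}. Q n})" for Q
    by (simp add: of_bool_def sum.inter_filter[symmetric])
  have x_card: "x a = real (card {n\<in>{..<p}. b n mod m = a}) / p - 1 / m" for a
    unfolding x_def c_def sum_c ..

  \<comment> \<open>Each of the \<open>h\<close> shifts by \<open>i < h\<close> alters the sum over
    \<open>n\<close> by at most \<open>h\<close>.\<close>
  have xy: "\<bar>x a - y a\<bar> \<le> h / p" for a
  proof -
    have shift: "\<bar>(\<Sum>n<p. c a (n + i)) - (\<Sum>n<p. c a n)\<bar> \<le> h" if "i < h" for i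
      using sum_shift_le[of "c a" i p] that by (force simp: c_def)
    have "y a = ((\<Sum>n<p. \<Sum>i<h. c a (n + i)) / h - p / m) / p"
      unfolding y_def v_def by (simp add: sum_subtractf sum_divide_distrib)
    also have "(\<Sum>n<p. \<Sum>i<h. c a (n + i)) = (\<Sum>i<h. \<Sum>n<p. c a (n + i))" by (rule sum.swap)
    finally have y: "y a = ((\<Sum>i<h. \<Sum>n<p. c a (n + i)) / h - p / m) / p" .
    have "(A / H - q) / R * (H * R) = A - H * q" if "H > 0" "R > 0" for A H R q :: real
      using that by (simp add: field_simps)
    from this[of h p "\<Sum>i<h. \<Sum>n<p. c a (n + i)" "p / m"] h p
    have "y a * (h * p) = (\<Sum>i<h. \<Sum>n<p. c a (n + i)) - h * (p / m)"
      unfolding y by (simp only: of_nat_0_less_iff of_nat_mult)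
    moreover have "(B / R - 1 / M) * (H * R) = H * B - H * (R / M)" if "R > 0" for B H R M :: real
      using that by (simp add: left_diff_distrib)
    hence "x a * (h * p) = h * (\<Sum>n<p. c a n) - h * (p / m)"
      using p unfolding x_def by simp
    ultimately have "(y a - x a) * (h * p) = (\<Sum>i<h. \<Sum>n<p. c a (n + i)) - h * (\<Sum>n<p. c a n)"
      by (simp add: left_diff_distrib)
    also have "\<dots> = (\<Sum>i<h. (\<Sum>n<p. c a (n + i)) - (\<Sum>n<p. c a n))" by (simp add: sum_subtractf)
    finally have diff: "(y a - x a) * (h * p) = (\<Sum>i<h. (\<Sum>n<p. c a (n + i)) - (\<Sum>n<p. c a n))" .
    have "\<bar>(y a - x a) * (h * p)\<bar> \<le> (\<Sum>i<h. real h)"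
      unfolding diff by (rule order_trans[OF sum_abs sum_mono]) (simp add: shift)
    hence "\<bar>y a - x a\<bar> * (h * p) \<le> h / p * (h * p)" using h p by (simp add: abs_mult)
    hence "\<bar>y a - x a\<bar> \<le> h / p" using h p by (subst (asm) mult_le_cancel_right_pos) auto
    thus ?thesis by (simp add: abs_minus_commute)
  qed

  have c_pair: "(\<Sum>a<m. c a k * c a k') = of_bool (b k mod m = b k' mod m)" for k k'
  proof -
    have "(\<Sum>a<m. c a k * c a k') = (\<Sum>a<m. if b k mod m = a then c a k' else 0)"
      by (intro sum.cong) (auto simp: c_def)
    also have "\<dots> = c (b k mod m) k'" using m by (subst sum.delta') auto
    finally show ?thesis by (simp add: c_def eq_commute[of "b k' mod m"])
  qed
  have c_one: "(\<Sum>a<m. c a k) = 1" for k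
  proof -
    have "c a k * c a k = c a k" for a by (simp add: c_def)
    thus ?thesis using c_pair[of k k] by (simp only: simp_thms of_bool_eq)
  qed
  \<comment> \<open>Summing over \<open>a\<close> turns products of indicators into coincidences
    modulo \<open>m\<close>; the cross term \<open>- 2 / m\<close> and the square
    \<open>1 / m\<close> combine to \<open>- 1 / m\<close>.\<close>
  have v_sq: "(\<Sum>a<m. (v a n)\<^sup>2)
      = (\<Sum>i<h. \<Sum>j<h. of_bool (b (n + i) mod m = b (n + j) mod m)) / h\<^sup>2 - 1 / m" for n
  proof -
    have "(\<Sum>a<m. (\<Sum>i<h. c a (n + i))\<^sup>2) = (\<Sum>a<m. \<Sum>i<h. \<Sum>j<h. c a (n + i) * c a (n + j))"
      by (simp add: power2_eq_square sum_product)
    also have "\<dots> = (\<Sum>i<h. \<Sum>j<h. \<Sum>a<m. c a (n + i) * c a (n + j))"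
      by (rule trans[OF sum.swap sum.cong[OF refl sum.swap]])
    finally have sq: "(\<Sum>a<m. (\<Sum>i<h. c a (n + i))\<^sup>2)
      = (\<Sum>i<h. \<Sum>j<h. of_bool (b (n + i) mod m = b (n + j) mod m))" unfolding c_pair .
    have "(\<Sum>a<m. \<Sum>i<h. c a (n + i)) = (\<Sum>i<h. \<Sum>a<m. c a (n + i))" by (rule sum.swap)
    hence lin: "(\<Sum>a<m. \<Sum>i<h. c a (n + i)) = h" unfolding c_one by simp
    have "(\<Sum>a<m. (v a n)\<^sup>2) = (\<Sum>a<m. (\<Sum>i<h. c a (n + i))\<^sup>2 / h\<^sup>2
        - 2 / (h * m) * (\<Sum>i<h. c a (n + i)) + 1 / m\<^sup>2)"
      unfolding v_def by (intro sum.cong refl) (simp add: power2_diff power_divide)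
    also have "\<dots> = (\<Sum>a<m. (\<Sum>i<h. c a (n + i))\<^sup>2) / h\<^sup>2
        - 2 / (h * m) * (\<Sum>a<m. \<Sum>i<h. c a (n + i)) + m * (1 / m\<^sup>2)"
      by (simp add: sum.distrib sum_subtractf sum_divide_distrib sum_distrib_left)
    also have "\<dots> = (\<Sum>a<m. (\<Sum>i<h. c a (n + i))\<^sup>2) / h\<^sup>2 - 1 / m"
      unfolding lin using h m by (simp add: power2_eq_square)
    finally show ?thesis unfolding sq .
  qed

  have pair: "real (card {n\<in>{..<p}. b (n + i) mod m = b (n + j) mod m})
      \<le> p / m + p * P (if i \<le> j then j - i else i - j) + E" if ij: "i < h" "j < h" for i j
  proof -
    have *: "real (card {n\<in>{..<p}. b (n + i + l) mod m = b (n + i) mod m}) \<le> p / m + p * P l + E"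
      if "l \<le> h" for i l
    proof -
      have "p * subset_mean l (\<lambda>k. of_bool (m dvd k)) = p / m + p * P l"
        unfolding P_def right_diff_distrib by simp
      with card_walk_return_le[OF s per e W Z W0 b that, of i m] show ?thesis unfolding E_def by linarith
    qed
    show ?thesis
    proof (cases "i \<le> j")
      case True
      hence "n + i + (j - i) = n + j" for n by simp
      thus ?thesis using *[of "j - i" i] ij True
        by (simp add: eq_commute[of "b (_ + j) mod m"])
    next
      case False
      hence "n + j + (i - j) = n + i" for n by simp
      thus ?thesis using *[of "i - j" j] ij False by simp
    qed
  qed
  have Psum: "(\<Sum>j<h. P (if i \<le> j then j - i else i - j)) \<le> 2 * 2" if "i < h" for i
    by (rule sum_dist_le[OF _ _ that])
      (use sum_subset_mean_dvd_le[OF m] m in \<open>auto simp: P_def subset_mean_def\<close>)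
  have "(\<Sum>i<h. \<Sum>j<h. real (card {n\<in>{..<p}. b (n + i) mod m = b (n + j) mod m}))
      \<le> (\<Sum>i<h. \<Sum>j<h. p / m + p * P (if i \<le> j then j - i else i - j) + E)"
    by (intro sum_mono pair) auto
  also have "\<dots> = (\<Sum>i<h. h * (p / m + E) + p * (\<Sum>j<h. P (if i \<le> j then j - i else i - j)))"
    by (simp add: sum.distrib sum_distrib_left algebra_simps)
  also have "\<dots> \<le> (\<Sum>i<h. h * (p / m + E) + p * 4)"
    using mult_left_mono[OF Psum, of _ "real p"] by (intro sum_mono add_left_mono) simp
  finally have pairs: "(\<Sum>i<h. \<Sum>j<h. real (card {n\<in>{..<p}. b (n + i) mod m = b (n + j) mod m}))
      \<le> h * (h * (p / m + E) + p * 4)" by simp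

  \<comment> \<open>Cauchy-Schwarz reduces to the pair counts, whose main term \<open>p / m\<close>
    cancels against the \<open>- 1 / m\<close> of \<open>v_sq\<close>.\<close>
  have "(\<Sum>a<m. (y a)\<^sup>2) \<le> (\<Sum>a<m. (\<Sum>n<p. (v a n)\<^sup>2) / p)"
    unfolding y_def by (intro sum_mono sum_square_mean_le p)
  also have "\<dots> = (\<Sum>n<p. \<Sum>a<m. (v a n)\<^sup>2) / p"
    unfolding sum_divide_distrib[symmetric] by (subst sum.swap) simp
  also have "(\<Sum>n<p. \<Sum>a<m. (v a n)\<^sup>2)
      = (\<Sum>n<p. \<Sum>i<h. \<Sum>j<h. of_bool (b (n + i) mod m = b (n + j) mod m)) / h\<^sup>2 - p / m"
    unfolding v_sq by (simp add: sum_subtractf sum_divide_distrib)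
  also have "(\<Sum>n<p. \<Sum>i<h. \<Sum>j<h. of_bool (b (n + i) mod m = b (n + j) mod m))
      = (\<Sum>i<h. \<Sum>j<h. real (card {n\<in>{..<p}. b (n + i) mod m = b (n + j) mod m}))"
    unfolding sum_c[symmetric] by (rule trans[OF sum.swap sum.cong[OF refl sum.swap]])
  also have "(\<dots> / h\<^sup>2 - p / m) / p \<le> (h * (h * (p / m + E) + p * 4) / h\<^sup>2 - p / m) / p"
    using pairs by (intro divide_right_mono diff_right_mono) auto
  also have "\<dots> = 4 / h + E / p" proof -
    have "(H * (H * (q + E) + R * 4) / H\<^sup>2 - q) / R = 4 / H + E / R" if "H > 0" "R > 0" for H R q :: real
    proof -
      have "H * (H * (q + E) + R * 4) / H\<^sup>2 = q + E + R * 4 / H"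
        using that by (simp add: power2_eq_square add_divide_distrib)
      thus ?thesis using that by (simp add: add_divide_distrib)
    qed
    thus ?thesis using h p by simp
  qed
  finally have ysum: "(\<Sum>a<m. (y a)\<^sup>2) \<le> 4 / h + E / p" .

  have "(x a)\<^sup>2 \<le> 2 * (y a)\<^sup>2 + 2 * (h / p)\<^sup>2" for a
  proof -
    have "(x a - y a)\<^sup>2 \<le> (h / p)\<^sup>2" using xy[of a] by (intro abs_le_square_iff[THEN iffD1]) simp
    moreover have "(x a)\<^sup>2 = 2 * (x a - y a)\<^sup>2 - (x a - 2 * y a)\<^sup>2 + 2 * (y a)\<^sup>2"
      by (simp add: power2_eq_square algebra_simps)
    moreover have "0 \<le> (x a - 2 * y a)\<^sup>2" by simp
    ultimately show ?thesis by linarith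
  qed
  hence "(\<Sum>a<m. (x a)\<^sup>2) \<le> (\<Sum>a<m. 2 * (y a)\<^sup>2 + 2 * (h / p)\<^sup>2)" by (intro sum_mono)
  also have "\<dots> = 2 * (\<Sum>a<m. (y a)\<^sup>2) + 2 * m * (h / p)\<^sup>2"
    by (simp add: sum.distrib sum_distrib_left)
  also have "\<dots> \<le> 2 * (4 / h + E / p) + 2 * m * (h / p)\<^sup>2" using ysum by simp
  finally show ?thesis unfolding x_card E_def by (simp add: algebra_simps)
qed

subsection \<open>The discrepancy of the counts\<close>

text \<open>Two values among -1, 0, 1 that are congruent modulo \<open>p > 2\<close> coincide, so
  identities for Legendre symbols can be checked on the powers in Euler's criterion.\<close>

lemma Legendre_eqI:
  assumes p: "prime p" "2 < p" and "[a ^ ((p - 1) div 2) = y] (mod int p)" "y \<in> {-1, 0, 1}"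
  shows "Legendre a (int p) = y"
proof -
  let ?L = "Legendre a (int p)"
  have "[?L = y] (mod int p)" using euler_criterion[OF p] assms(3) by (rule cong_trans)
  hence "int p dvd ?L - y" by (simp add: cong_iff_dvd_diff)
  moreover have "?L \<in> {-1, 0, 1}" by (simp add: Legendre_def)
  hence "\<bar>?L - y\<bar> < int p" using p(2) assms(4) by auto
  ultimately show ?thesis using zdvd_not_zless[of "\<bar>?L - y\<bar>" "int p"] by auto
qed

lemma Legendre_mult:
  assumes p: "prime p" "2 < p"
  shows "Legendre (a * b) (int p) = Legendre a (int p) * Legendre b (int p)"
proof (rule Legendre_eqI[OF p])
  show "[(a * b) ^ ((p - 1) div 2) = Legendre a (int p) * Legendre b (int p)] (mod int p)"
    unfolding power_mult_distrib by (intro cong_mult cong_sym[OF euler_criterion[OF p]])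
qed (auto simp: Legendre_def)

lemma Legendre_prod:
  assumes p: "prime p" "2 < p" and "finite S"
  shows "Legendre (\<Prod>i\<in>S. f i) (int p) = (\<Prod>i\<in>S. Legendre (f i) (int p))"
  using assms(3)
proof (induction S)
  case empty
  show ?case by (simp add: Legendre_eqI[OF p])
qed (simp add: Legendre_mult[OF p])

lemma Legendre_poly_periodic: "Legendre (poly F (int (n + p))) (int p) = Legendre (poly F (int n)) (int p)"
proof -
  have "[poly F (int (n + p)) = poly F (int n)] (mod int p)"
  proof (induction F)
    case (pCons a F)
    have "[int (n + p) = int n] (mod int p)" by (simp add: cong_def)
    thus ?case unfolding poly_pCons by (intro cong_add cong_mult cong_refl pCons.IH)
  qed simp
  hence "[poly F (int (n + p)) = y] (mod int p) \<longleftrightarrow> [poly F (int n) = y] (mod int p)" for y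
    using cong_trans cong_sym by blast
  thus ?thesis unfolding Legendre_def QuadRes_def by (simp add: cong_sym_eq[of _ "poly F _"])
qed

text \<open>Each square is at most \<open>\<bar>u - 1 / m\<bar> \<le> u + 1 / m\<close> for the
  density \<open>u\<close>, and both the densities and the terms \<open>1 / m\<close> add up to
  1.\<close>

lemma sum_mod_discrepancy_le_2:
  fixes b :: "nat \<Rightarrow> nat" and p m :: nat
  assumes "p > 0" "m > 0"
  shows "(\<Sum>a<m. (real (card {n\<in>{..<p}. b n mod m = a}) / p - 1 / m)\<^sup>2) \<le> 2"
proof -
  let ?u = "\<lambda>a. real (card {n\<in>{..<p}. b n mod m = a}) / p"
  have "(?u a - 1 / m)\<^sup>2 \<le> ?u a + 1 / m" for a
  proof -
    have "card {n\<in>{..<p}. b n mod m = a} \<le> card {..<p}" by (intro card_mono) auto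
    hence "0 \<le> ?u a" "?u a \<le> 1" "0 \<le> 1 / real m" "1 / real m \<le> 1" using assms by auto
    moreover have "(x - y)\<^sup>2 \<le> x + y" if "0 \<le> x" "x \<le> 1" "0 \<le> y" "y \<le> 1" for x y :: real
    proof -
      have "(x - y)\<^sup>2 = \<bar>x - y\<bar> * \<bar>x - y\<bar>" by (simp add: power2_eq_square)
      also have "\<dots> \<le> 1 * \<bar>x - y\<bar>" using that by (intro mult_right_mono) auto
      also have "\<dots> \<le> x + y" using that by simp
      finally show ?thesis .
    qed
    ultimately show ?thesis by blast
  qed
  hence "(\<Sum>a<m. (?u a - 1 / m)\<^sup>2) \<le> (\<Sum>a<m. ?u a + 1 / m)" by (intro sum_mono)
  also have "\<dots> = (\<Sum>a<m. ?u a) + 1" using assms by (simp add: sum.distrib)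
  also have "(\<Sum>a<m. ?u a) = real (\<Sum>a<m. card {n\<in>{..<p}. b n mod m = a}) / p"
    by (simp add: sum_divide_distrib)
  also have "(\<Sum>a<m. card {n\<in>{..<p}. b n mod m = a}) = card (\<Union>a<m. {n\<in>{..<p}. b n mod m = a})"
    by (rule card_UN_disjoint[symmetric]) auto
  also have "(\<Union>a<m. {n\<in>{..<p}. b n mod m = a}) = {..<p}" using assms by auto
  finally show ?thesis using assms by simp
qed

lemma card_mod_Suc_eq:
  fixes c :: "nat \<Rightarrow> nat"
  assumes "a < m"
  shows "card {k\<in>{1..p}. [c k = a] (mod m)} = card {n\<in>{..<p}. c (Suc n) mod m = a}"
proof -
  have "a mod m = a" using assms by simp
  hence "{k\<in>{1..p}. [c k = a] (mod m)} = Suc ` {n\<in>{..<p}. c (Suc n) mod m = a}"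
  proof (intro equalityI subsetI)
    fix k assume "k \<in> {k\<in>{1..p}. [c k = a] (mod m)}"
    thus "k \<in> Suc ` {n\<in>{..<p}. c (Suc n) mod m = a}"
      using \<open>a mod m = a\<close> by (intro image_eqI[of _ _ "k - 1"]) (auto simp: cong_def)
  qed (use \<open>a mod m = a\<close> in \<open>auto simp: cong_def\<close>)
  thus ?thesis by (simp add: card_image)
qed

text \<open>The choice of \<open>h\<close> makes \<open>2 ^ h\<close>, \<open>h\<close> and
  \<open>D\<close> all at most \<open>t\<close>, so the pattern error is at most
  \<open>10 * t ^ 7\<close>, which is \<open>10 * p / t\<close>. The three terms are then at most
  \<open>8 / h\<close>, \<open>20 / h\<close> and \<open>2 / h\<close>, and
  \<open>h \<ge> ln p / 16\<close> turns \<open>30 / h\<close> into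
  \<open>480 / ln p\<close>.\<close>

lemma numeric_bound:
  fixes p D m h :: nat
  defines "t \<equiv> p powr (1 / 8)" and "h \<equiv> nat \<lfloor>log 2 p / 8\<rfloor>"
  assumes p: "p \<ge> 2 ^ 32" and D: "real D \<le> t" and m: "2 \<le> m" "(real m)\<^sup>2 < ln p"
  shows "0 < h" "16 * (D * h) \<le> p"
    "8 / h + 2 * (2 ^ h * (9 * (D * h) * sqrt p + real h * real D)) / p + 2 * real m * (h / p)\<^sup>2
      \<le> 480 * ((real m)\<^sup>2 / ln p)"
proof -
  have "real (2 ^ 32) \<le> real p" using p by (rule of_nat_mono)
  hence p0: "real p > 0" "real p \<ge> 2 ^ 32" by simp_all
  have t8: "t ^ 8 = p" using p0 by (simp add: t_def powr_power)
  have "(t ^ 4)\<^sup>2 = t ^ 8" by (simp flip: power_mult)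
  hence t4: "sqrt p = t ^ 4"
    unfolding t8 by (rule real_sqrt_unique) simp
  have t16: "t \<ge> 16"
  proof (rule ccontr)
    assume "\<not> t \<ge> 16"
    hence "t < 16" by simp
    moreover have "0 \<le> t" unfolding t_def by simp
    ultimately have "t ^ 8 < 16 ^ 8" by (rule power_strict_mono) simp
    moreover have "(16::real) ^ 8 = 2 ^ 32" by simp
    ultimately show False using p0(2) unfolding t8 by linarith
  qed
  define l where "l = log 2 p"
  have l32: "l \<ge> 32"
    using p0 le_log_iff[of 2 "real p" 32] by (simp add: l_def powr_realpow flip: powr_realpow)
  have hl: "real h \<le> l / 8" "real h > l / 8 - 1" using l32 unfolding h_def l_def by linarith+
  show h: "0 < h" using hl l32 by linarith
  have "(2::real) ^ h = 2 powr h" by (simp add: powr_realpow)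
  also have "\<dots> \<le> 2 powr (l / 8)" using hl by simp
  also have "\<dots> = (2 powr l) powr (1 / 8)" by (simp add: powr_powr)
  also have "2 powr l = p" using p0 by (simp add: l_def)
  also have "p powr (1 / 8) = t" by (simp add: t_def)
  finally have h2: "2 ^ h \<le> t" .
  have "real h < 2 ^ h" by (rule of_nat_less_two_power)
  hence ht: "real h \<le> t" using h2 by linarith
  have Dh: "real D * h \<le> t\<^sup>2" unfolding power2_eq_square using D ht t16 by (intro mult_mono) auto
  have t_mono: "t ^ i \<le> t ^ j" if "i \<le> j" for i j using that t16 by (intro power_increasing) auto
  have "16 * (real D * h) \<le> t * t ^ 2" using Dh t16 by (intro mult_mono) auto
  also have "\<dots> \<le> t ^ 8" using t_mono[of 3 8] by (simp add: power3_eq_cube power2_eq_square)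
  finally have "real (16 * (D * h)) \<le> real p" unfolding t8 by simp
  thus "16 * (D * h) \<le> p" by (simp only: of_nat_le_iff)
  have "9 * (D * h) * sqrt p + real h * real D \<le> 9 * t ^ 6 + t ^ 6"
  proof (rule add_mono)
    have "9 * (real D * h) * sqrt p \<le> 9 * t\<^sup>2 * t ^ 4" unfolding t4 using Dh t16 by (intro mult_right_mono) auto
    thus "9 * (D * h) * sqrt p \<le> 9 * t ^ 6" by (simp flip: power_add)
    show "real h * real D \<le> t ^ 6" using Dh t_mono[of 2 6] by (simp add: mult.commute)
  qed
  hence "2 ^ h * (9 * (D * h) * sqrt p + real h * real D) \<le> t * (9 * t ^ 6 + t ^ 6)"
    using h2 t16 by (intro mult_mono) auto
  also have "\<dots> = 10 * t ^ 7" by (simp add: power_Suc[of t 6, symmetric] del: power_Suc)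
  finally have "2 * (2 ^ h * (9 * (D * h) * sqrt p + real h * real D)) / p \<le> 20 * t ^ 7 / p"
    by (intro divide_right_mono) simp_all
  also have t78: "t ^ 7 / p = 1 / t"
    using t16 power_Suc[of t 7] unfolding t8[symmetric] by simp
  hence "20 * t ^ 7 / p = 20 / t" by (simp only: times_divide_eq_right[symmetric] mult_1_right)
  also have "\<dots> \<le> 20 / h" using h ht by (intro divide_left_mono) auto
  finally have 1: "2 * (2 ^ h * (9 * (D * h) * sqrt p + real h * real D)) / p \<le> 20 / h" .
  have "real m * 1 \<le> real m * real m" using m by (intro mult_left_mono) auto
  also have "\<dots> \<le> p" using m(2) ln_le_minus_one[of p] p0 unfolding power2_eq_square by linarith
  finally have "2 * real m * (h / p)\<^sup>2 \<le> 2 * p * (t / p)\<^sup>2"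
    using ht by (intro mult_mono power_mono divide_right_mono) auto
  also have "\<dots> = 2 * t\<^sup>2 / p" using p0 by (simp add: power2_eq_square)
  also have "\<dots> \<le> 2 * t ^ 7 / p" using t_mono[of 2 7] by (intro divide_right_mono) auto
  also have "\<dots> = 2 / t" using t78 by (simp only: times_divide_eq_right[symmetric] mult_1_right)
  also have "\<dots> \<le> 2 / h" using h ht by (intro divide_left_mono) auto
  finally have 2: "2 * real m * (h / p)\<^sup>2 \<le> 2 / h" .
  have "ln p \<le> l"
  proof -
    have "ln (2::real) \<le> 1" using ln_le_minus_one[of 2] by simp
    moreover have "ln p \<ge> 0" "ln (2::real) > 0" using p0 by auto
    ultimately show ?thesis unfolding l_def log_def by (simp add: le_divide_eq mult_left_le)
  qed
  moreover have "real h \<ge> l / 16" using hl l32 by linarith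
  ultimately have hln: "real h \<ge> ln p / 16" by linarith
  have ln0: "ln p > 0" using p0 by simp
  have "30 / h \<le> 30 / (ln p / 16)" using hln ln0 h by (intro divide_left_mono) auto
  also have "\<dots> = 480 * (1 / ln p)" by simp
  also have "\<dots> \<le> 480 * ((real m)\<^sup>2 / ln p)"
    using m ln0 by (intro mult_left_mono divide_right_mono) (auto simp: one_le_power)
  finally show "8 / h + 2 * (2 ^ h * (9 * (D * h) * sqrt p + real h * real D)) / p + 2 * real m * (h / p)\<^sup>2
      \<le> 480 * ((real m)\<^sup>2 / ln p)"
    using 1 2 by simp
qed

text \<open>
  When \<open>m\<^sup>2 \<ge> ln p\<close> or \<open>p powr (1 / 8)\<close> is less than the degree of \<open>F\<close>, the right-hand side is at least
  2 and the bound is trivial.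
\<close>

lemma count_discrepancy_le:
  fixes F :: "int poly" and m :: nat
  assumes p: "prime p" "p \<ge> 2 ^ 32" and sf: "poly_mod.square_free_m (int p) F"
    and D: "poly_mod.degree_m (int p) F \<ge> 1" and m: "2 \<le> m" and e: "e = 1 \<or> e = -1"
  defines "c \<equiv> \<lambda>k. card {n \<in> {1..k}. Legendre (poly F (int n)) (int p) = e}"
  shows "(\<Sum>a = 0..m - 1. (Phi p c m a - 1 / real m)\<^sup>2)
    \<le> (480 + 16 * real (poly_mod.degree_m (int p) F)) * ((real m)\<^sup>2 / ln (real p))"
proof -
  let ?D = "poly_mod.degree_m (int p) F"
  define t where "t = real p powr (1 / 8)"
  define R where "R = (real m)\<^sup>2 / ln (real p)"
  let ?S = "\<Sum>a<m. (real (card {n\<in>{..<p}. c (Suc n) mod m = a}) / p - 1 / m)\<^sup>2"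
  have p1024: "p \<ge> 1024" "2 < p" "0 < p" using p(2) by simp_all
  have ln0: "ln (real p) > 0" using p1024 by simp
  have "{0..m - 1} = {..<m}" using m by auto
  hence S: "(\<Sum>a = 0..m - 1. (Phi p c m a - 1 / real m)\<^sup>2) = ?S"
    unfolding Phi_def by (intro sum.cong) (simp_all only: card_mod_Suc_eq lessThan_iff)
  have S2: "?S \<le> 2" using m p1024 by (intro sum_mod_discrepancy_le_2) auto
  have R0: "R \<ge> 0" unfolding R_def using ln0 by simp
  have "?S \<le> 480 * R + 16 * real ?D * R"
  proof -
    consider "ln (real p) \<le> (real m)\<^sup>2" | "t < ?D" | "(real m)\<^sup>2 < ln (real p)" "?D \<le> t" by linarith
    thus ?thesis
    proof cases
      case 1
      hence "R \<ge> 1" using ln0 by (simp add: R_def)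
      moreover have "0 \<le> 16 * real ?D * R" using R0 by simp
      ultimately show ?thesis using S2 by linarith
    next
      \<comment> \<open>Here \<open>ln p = 8 * ln t \<le> 8 * t < 8 * D\<close>; the coefficient 16
        is chosen to make \<open>16 * D * R\<close> at least 2.\<close>
      case 2
      have "ln (real p) = 8 * ln t" using p1024 by (simp add: t_def ln_powr)
      also have "ln t \<le> t" using ln_le_minus_one[of t] p1024 by (simp add: t_def)
      finally have "ln (real p) \<le> 8 * real ?D" using 2 by simp
      hence "2 * ln (real p) \<le> 16 * real ?D * 1" by simp
      also have "\<dots> \<le> 16 * real ?D * (real m)\<^sup>2" using m by (intro mult_left_mono) auto
      finally have "2 \<le> 16 * real ?D * R" unfolding R_def using ln0 by (simp add: field_simps)
      thus ?thesis using S2 R0 by linarith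
    next
      case 3
      define h where "h = nat \<lfloor>log 2 p / 8\<rfloor>"
      note num = numeric_bound[OF p(2) 3(2)[unfolded t_def] m 3(1), folded h_def]
      let ?s = "\<lambda>n. Legendre (poly F (int n)) (int p)"
      have bnd: "card {n\<in>{..<p}. ?s n = 0} \<le> ?D"
        "\<And>S. S \<noteq> {} \<Longrightarrow> S \<subseteq> {..<h} \<Longrightarrow>
          \<bar>\<Sum>n<p. real_of_int (Legendre (\<Prod>i\<in>S. poly F (int (n + i))) (int p))\<bar> \<le> 9 * (?D * h) * sqrt p"
        using shifted_Legendre_bound[OF p(1) p1024(1)] sf D num(2) unfolding shifted_Legendre_bound_def by simp_all
      have "?S \<le> 8 / h + 2 * (2 ^ h * (9 * (?D * h) * sqrt p + real h * real ?D)) / p + 2 * real m * (h / p)\<^sup>2"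
      \<comment> \<open>The walk is \<open>b n = c (Suc n)\<close>, because \<open>k\<close> runs
        from 1. Its step from \<open>k\<close> to \<open>Suc k\<close> looks at the symbol at
        \<open>k + 2\<close>, hence \<open>r = 2\<close>.\<close>
      proof (rule walk_equidistribution[where s = ?s and e = e and r = 2])
        show "?s n \<in> {-1, 0, 1}" for n by (simp add: Legendre_def)
        show "?s (n + p) = ?s n" for n by (rule Legendre_poly_periodic)
        show "\<bar>\<Sum>n<p. real_of_int (\<Prod>i\<in>S. ?s (n + i))\<bar> \<le> 9 * (?D * h) * sqrt p"
          if "S \<noteq> {}" "S \<subseteq> {..<h}" for S
          using bnd(2)[OF that] Legendre_prod[OF p(1) p1024(2) finite_subset[OF that(2)]] by simp
        show "c (Suc (Suc k)) = c (Suc k) + of_bool (?s (k + 2) = e)" for k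
        proof -
          have "{n \<in> {1..Suc (Suc k)}. ?s n = e} = (if ?s (k + 2) = e then insert (k + 2) {n \<in> {1..Suc k}. ?s n = e}
              else {n \<in> {1..Suc k}. ?s n = e})"
            by (auto simp: le_Suc_eq)
          thus ?thesis unfolding c_def by simp
        qed
      qed (use bnd e m num(1) p1024 in simp_all)
      also have "\<dots> \<le> 480 * R" unfolding R_def by (rule num(3))
      finally have "?S \<le> 480 * R" .
      moreover have "0 \<le> 16 * real ?D * R" using R0 by simp
      ultimately show ?thesis by linarith
    qed
  qed
  also have "\<dots> = (480 + 16 * real ?D) * R" by (simp only: distrib_right)
  finally show ?thesis unfolding S R_def .
qed

text \<open>\<open>K\<close> is the implied constant in the range of \<open>m\<close>, and the
  threshold for large \<open>p\<close> is chosen after it. The implied constant \<open>C\<close> of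
  the conclusion is a function of the degree alone, so it is chosen first.\<close>

theorem theorem2:
  shows "\<exists>C :: nat \<Rightarrow> real. \<forall>K :: real. K > 0 \<longrightarrow> (\<exists>p0 :: nat. \<forall>p :: nat. p \<ge> p0 \<longrightarrow> prime p \<longrightarrow>
    (\<forall>(F :: int poly) (m :: nat).
      poly_mod.square_free_m (int p) F \<longrightarrow>
      poly_mod.degree_m (int p) F \<ge> 1 \<longrightarrow>
      2 \<le> m \<longrightarrow> real m \<le> K * ln (real p) powr (1 / 4) \<longrightarrow>
      (\<Sum>a = 0..m - 1. (Phi p (R_count p F) m a - 1 / real m)\<^sup>2)
        \<le> C (poly_mod.degree_m (int p) F) * ((real m)\<^sup>2 / ln (real p)) \<and>
      (\<Sum>a = 0..m - 1. (Phi p (N_count p F) m a - 1 / real m)\<^sup>2)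
        \<le> C (poly_mod.degree_m (int p) F) * ((real m)\<^sup>2 / ln (real p))))"
proof (intro exI[of _ "\<lambda>D. 480 + 16 * real D"] allI impI)
  fix K :: real
  show "\<exists>p0 :: nat. \<forall>p :: nat. p \<ge> p0 \<longrightarrow> prime p \<longrightarrow>
    (\<forall>(F :: int poly) (m :: nat).
      poly_mod.square_free_m (int p) F \<longrightarrow>
      poly_mod.degree_m (int p) F \<ge> 1 \<longrightarrow>
      2 \<le> m \<longrightarrow> real m \<le> K * ln (real p) powr (1 / 4) \<longrightarrow>
      (\<Sum>a = 0..m - 1. (Phi p (R_count p F) m a - 1 / real m)\<^sup>2)
        \<le> (480 + 16 * real (poly_mod.degree_m (int p) F)) * ((real m)\<^sup>2 / ln (real p)) \<and>
      (\<Sum>a = 0..m - 1. (Phi p (N_count p F) m a - 1 / real m)\<^sup>2)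
        \<le> (480 + 16 * real (poly_mod.degree_m (int p) F)) * ((real m)\<^sup>2 / ln (real p)))"
    \<comment> \<open>Residues and non-residues are the cases \<open>e = 1\<close> and
      \<open>e = -1\<close> of \<open>count_discrepancy_le\<close>, which also supplies the
      threshold \<open>2 ^ 32\<close>.\<close>
    unfolding R_count_def[abs_def] N_count_def[abs_def]
  proof (intro exI[of _ "2 ^ 32"] allI impI conjI, goal_cases)
    case (1 p F m)
    thus ?case by (intro count_discrepancy_le) simp_all
  next
    case (2 p F m)
    thus ?case by (intro count_discrepancy_le) simp_all
  qed
qed


end
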